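(* In algorithm AC-ASO (described in the context), each lattice operation takes $O(\sqrt{k})$ message delays in the worst case, where $k\le f$ is the actual number of crash failures in the execution.
   Context: Model: asynchronous message-passing system with $n$ nodes $1,\dots,n$, at most $f<n/2$ of which may crash; reliable FIFO channels between every pair of nodes (a message whose send command is completed is eventually delivered if the receiver has not crashed, and messages from $i$ to $j$ are delivered in sending order). Each node is sequential: it has at most one pending SCAN or UPDATE operation at any time. Local computation time is negligible. $D$ is the maximum message delay of the execution: a message between two nonfaulty nodes is received within time $D$. An operation takes at most $c$ message delays (rounds) if it completes within time $cD$ of its start. Algorithm AC-ASO, at node $i$. Variables: vector of sets $V_i[1..n]$ (initially all empty), integer $maxTag_i$ (initially 0), vector of sets $D_i[1..n]$ (initially all empty). Elements of these sets are value-timestamp pairs $\langle v,\langle r,j\rangle\rangle$, where the integer $r$ is the tag and $j$ the writer. For a set $H$, $H^{\le r}$ is its subset of elements with tag at most $r$; $V^{\le r}=[V[1]^{\le r},\dots,V[n]^{\le r}]$. $\mathrm{EQ}(V,i)$ is true iff there is $Q\subseteq\{1,\dots,n\}$ with $|Q|\ge n-f$ and $V[j]=V[i]$ for all $j\in Q$. Procedures: - UPDATE$(v)$: $r\gets readTag()$; $ts\gets\langle r+1,i\rangle$; send ("value", $\langle v,ts\rangle$) to all; run $Lattice(r)$ (phase 0); $r'\gets\max\{r+1,maxTag_i\}$; run $LatticeRenewal(r')$; return ACK. - SCAN: $r\gets readTag()$; $S\gets LatticeRenewal(r)$; return $Snap$, where $Snap[j]$ is the value $v$ with $\langle v,\langle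 t',j\rangle\rangle\in S$ and $t'$ largest among $j$'s values in $S$. - $Lattice(r)$: run $writeTag(r)$; wait until $\mathrm{EQ}(V_i^{\le r},i)$ is true; then atomically, at the first moment it is true: let $V^*=V_i^{\le r}$; if $maxTag_i\le r$, send ("goodLA", $r$) to all and return $(true,V^*[i])$; else return $(false,\emptyset)$. - $LatticeRenewal(r)$: for phase $=1,2,3$: $(status,view)\gets Lattice(r)$; if $status=true$, return $view$; else if phase $=3$, leave the loop; otherwise set $r\gets maxTag_i$ and continue. After the loop, wait until ("goodLA", $r$) is received from some node $j$ and return $D_i[j]$. - $readTag()$: send ("readTag") to all, wait for at least $n-f$ ("readAck", $*$) messages, return the largest tag contained in them. - $writeTag(r)$: send ("writeTag", $r$) to all, wait for at least $n-f$ ("writeAck", $r$) messages. Message handlers (atomic, always running in the background): on ("value", $\langle u,ts\rangle$) from $j$: add $\langle u,ts\rangle$ to $V_i[j]$ and $V_i[i]$, and if it has not been seen before send ("value", $\langle u,ts\rangle$) to all. On ("writeTag", $r$) from $j$: $maxTag_i\gets\max\{maxTag_i,r\}$, send ("echoTag", $r$) to all, send ("writeAck", $r$) to $j$. On ("echoTag", $r$): $maxTag_i\gets\max\{maxTag_i,r\}$. On ("readTag") from $j$: send ("readAck", $maxTag_i$) to $j$. On ("goodLA", $r$) from $j$: $D_i[j]\gets V_i[j]^{\le r}$ (executed before any pending $LatticeRenewal$ waiting for this message returns). A lattice operation with tag $r$ is an execution of the procedure $Lattice(r)$ at some node.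
   Formalization: The delay bound D is assumed for every message whose send command completed and whose receiver has not crashed, including messages from nodes that crash, not only for messages between two nonfaulty nodes; otherwise late messages from k crashed writers can force about 2k delays. *)

theory Defs
  imports Complex_Main "HOL-Library.Landau_Symbols"
begin

type_synonym node = nat

text \<open>\<open>(v, (r, j))\<close> is the value \<open>v\<close> with tag \<open>r\<close> and writer \<open>j\<close>.\<close>

type_synonym 'v tsval = "'v \<times> (nat \<times> node)"

abbreviation tag_of :: "'v tsval \<Rightarrow> nat" where
  "tag_of x \<equiv> fst (snd x)"

definition upto_tag :: "nat \<Rightarrow> 'v tsval set \<Rightarrow> 'v tsval set" where
  "upto_tag r H = {x \<in> H. tag_of x \<le> r}"

definition EQ :: "nat \<Rightarrow> nat \<Rightarrow> (node \<Rightarrow> 'v tsval set) \<Rightarrow> node \<Rightarrow> bool" where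
  "EQ n f W i \<longleftrightarrow> (\<exists>Q \<subseteq> {1..n}. n - f \<le> card Q \<and> (\<forall>j \<in> Q. W j = W i))"

definition snapshot :: "'v tsval set \<Rightarrow> node \<Rightarrow> 'v option" where
  "snapshot S j =
    (if \<exists>v t. (v, (t, j)) \<in> S
     then Some (SOME v. \<exists>t. (v, (t, j)) \<in> S \<and> (\<forall>v' t'. (v', (t', j)) \<in> S \<longrightarrow> t' \<le> t))
     else None)"

text \<open>
  The number carried by \<open>ReadTag\<close> and \<open>ReadAck\<close> identifies the call of readTag, so that late
  acknowledgements of an earlier call by the same node are not counted for the current one.
\<close>

datatype 'v msg =
    Value "'v tsval"
  | WriteTag nat
  | WriteAck nat
  | EchoTag nat
  | ReadTag nat
  | ReadAck nat nat
  | GoodLA nat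

datatype 'v operation = Scan | Update 'v

datatype 'v response = Ack | Snap "node \<Rightarrow> 'v option"

text \<open>
  Program counter of the operation pending at a node. In \<open>CallLattice p r\<close>, \<open>WaitWrite p r\<close>,
  \<open>WaitEQ p r\<close> and \<open>LatticeDone p r status view\<close>, \<open>p\<close> is the phase (0 for the direct call in
  UPDATE, and 1, 2, 3 in LatticeRenewal) and \<open>r\<close> is the argument of Lattice. The procedure
  Lattice itself is being executed exactly in \<open>WaitWrite\<close> and \<open>WaitEQ\<close>.
\<close>

datatype 'v pc =
    Idle
  | CallRead
  | WaitRead
  | CallLattice nat nat
  | WaitWrite nat nat
  | WaitEQ nat nat
  | LatticeDone nat nat bool "'v tsval set"
  | WaitGoodLA nat
  | RenewalDone "'v tsval set"

record 'v node_state =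
  pending :: "'v operation option"
  result :: "'v response option"
  pc :: "'v pc"
  vals :: "node \<Rightarrow> 'v tsval set"         \<comment> \<open>the vector \<open>V\<^sub>i\<close>\<close>
  max_tag :: nat
  good_vals :: "node \<Rightarrow> 'v tsval set"    \<comment> \<open>the vector \<open>D\<^sub>i\<close>\<close>
  read_no :: nat
  read_acks :: "(node \<times> nat \<times> nat) set"
  write_acks :: "(node \<times> nat) set"
  good_rcvd :: "(node \<times> nat) set"

definition init_node :: "'v node_state" where
  "init_node = \<lparr>pending = None, result = None, pc = Idle, vals = (\<lambda>_. {}), max_tag = 0,
     good_vals = (\<lambda>_. {}), read_no = 0, read_acks = {}, write_acks = {}, good_rcvd = {}\<rparr>"

definition read_ackers :: "'v node_state \<Rightarrow> node set" where
  "read_ackers s = {j. \<exists>t. (j, read_no s, t) \<in> read_acks s}"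

definition read_result :: "'v node_state \<Rightarrow> nat" where
  "read_result s = Max {t. \<exists>j. (j, read_no s, t) \<in> read_acks s}"

definition write_ackers :: "nat \<Rightarrow> 'v node_state \<Rightarrow> node set" where
  "write_ackers r s = {j. (j, r) \<in> write_acks s}"

definition eq_holds :: "nat \<Rightarrow> nat \<Rightarrow> node \<Rightarrow> nat \<Rightarrow> 'v node_state \<Rightarrow> bool" where
  "eq_holds n f i r s \<longleftrightarrow> EQ n f (\<lambda>j. upto_tag r (vals s j)) i"

text \<open>
  A list of send commands: each entry is a message with its set of destinations. A message sent
  to all is also sent by the node to itself, over a channel like any other.
\<close>

type_synonym 'v sends = "('v msg \<times> node set) list"

text \<open>One step of the operation pending at node \<open>i\<close>: old state, new state, messages sent.\<close>

inductive local_step ::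
  "nat \<Rightarrow> nat \<Rightarrow> node \<Rightarrow> 'v node_state \<Rightarrow> 'v node_state \<Rightarrow> 'v sends \<Rightarrow> bool"
  for n f i where
  read_call:
    "pc s = CallRead \<Longrightarrow>
     local_step n f i s (s\<lparr>pc := WaitRead, read_no := Suc (read_no s)\<rparr>)
       [(ReadTag (Suc (read_no s)), {1..n})]"
| read_done_scan:
    "\<lbrakk>pc s = WaitRead; pending s = Some Scan; n - f \<le> card (read_ackers s)\<rbrakk> \<Longrightarrow>
     local_step n f i s (s\<lparr>pc := CallLattice 1 (read_result s)\<rparr>) []"
| read_done_update:
    "\<lbrakk>pc s = WaitRead; pending s = Some (Update v); n - f \<le> card (read_ackers s)\<rbrakk> \<Longrightarrow>
     local_step n f i s (s\<lparr>pc := CallLattice 0 (read_result s)\<rparr>)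
       [(Value (v, (read_result s + 1, i)), {1..n})]"
| lattice_call:
    "pc s = CallLattice p r \<Longrightarrow>
     local_step n f i s (s\<lparr>pc := WaitWrite p r, write_acks := {}\<rparr>) [(WriteTag r, {1..n})]"
| write_done:
    "\<lbrakk>pc s = WaitWrite p r; n - f \<le> card (write_ackers r s)\<rbrakk> \<Longrightarrow>
     local_step n f i s (s\<lparr>pc := WaitEQ p r\<rparr>) []"
| lattice_true:
    "\<lbrakk>pc s = WaitEQ p r; eq_holds n f i r s; max_tag s \<le> r\<rbrakk> \<Longrightarrow>
     local_step n f i s (s\<lparr>pc := LatticeDone p r True (upto_tag r (vals s i))\<rparr>)
       [(GoodLA r, {1..n})]"
| lattice_false:
    "\<lbrakk>pc s = WaitEQ p r; eq_holds n f i r s; \<not> max_tag s \<le> r\<rbrakk> \<Longrightarrow>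
     local_step n f i s (s\<lparr>pc := LatticeDone p r False {}\<rparr>) []"
| update_renewal:
    "pc s = LatticeDone 0 r status view \<Longrightarrow>
     local_step n f i s (s\<lparr>pc := CallLattice 1 (max (r + 1) (max_tag s))\<rparr>) []"
| renewal_direct:
    "\<lbrakk>pc s = LatticeDone p r True view; 1 \<le> p\<rbrakk> \<Longrightarrow>
     local_step n f i s (s\<lparr>pc := RenewalDone view\<rparr>) []"
| renewal_retry:
    "\<lbrakk>pc s = LatticeDone p r False view; 1 \<le> p; p < 3\<rbrakk> \<Longrightarrow>
     local_step n f i s (s\<lparr>pc := CallLattice (p + 1) (max_tag s)\<rparr>) []"
| renewal_leave:
    "pc s = LatticeDone 3 r False view \<Longrightarrow>
     local_step n f i s (s\<lparr>pc := WaitGoodLA r\<rparr>) []"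
| renewal_borrow:
    "\<lbrakk>pc s = WaitGoodLA r; (j, r) \<in> good_rcvd s\<rbrakk> \<Longrightarrow>
     local_step n f i s (s\<lparr>pc := RenewalDone (good_vals s j)\<rparr>) []"
| return_update:
    "\<lbrakk>pc s = RenewalDone view; pending s = Some (Update v)\<rbrakk> \<Longrightarrow>
     local_step n f i s (s\<lparr>pc := Idle, pending := None, result := Some Ack\<rparr>) []"
| return_scan:
    "\<lbrakk>pc s = RenewalDone view; pending s = Some Scan\<rbrakk> \<Longrightarrow>
     local_step n f i s
       (s\<lparr>pc := Idle, pending := None, result := Some (Snap (snapshot view))\<rparr>) []"

text \<open>Handlers at node \<open>i\<close> for a message from \<open>j\<close>: new state, and messages sent.\<close>

fun handle :: "node \<Rightarrow> node \<Rightarrow> 'v msg \<Rightarrow> 'v node_state \<Rightarrow> 'v node_state" where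
  "handle i j (Value x) s =
     s\<lparr>vals := (\<lambda>l. if l = i \<or> l = j then insert x (vals s l) else vals s l)\<rparr>"
| "handle i j (WriteTag r) s = s\<lparr>max_tag := max (max_tag s) r\<rparr>"
| "handle i j (WriteAck r) s = s\<lparr>write_acks := insert (j, r) (write_acks s)\<rparr>"
| "handle i j (EchoTag r) s = s\<lparr>max_tag := max (max_tag s) r\<rparr>"
| "handle i j (ReadTag q) s = s"
| "handle i j (ReadAck q t) s = s\<lparr>read_acks := insert (j, q, t) (read_acks s)\<rparr>"
| "handle i j (GoodLA r) s =
     s\<lparr>good_vals := (good_vals s)(j := upto_tag r (vals s j)),
       good_rcvd := insert (j, r) (good_rcvd s)\<rparr>"

text \<open>Every pair that node \<open>i\<close> has received is in \<open>vals s i\<close>, so membership means ``seen before''.\<close>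

fun handler_sends :: "nat \<Rightarrow> node \<Rightarrow> node \<Rightarrow> 'v msg \<Rightarrow> 'v node_state \<Rightarrow> 'v sends" where
  "handler_sends n i j (Value x) s = (if x \<in> vals s i then [] else [(Value x, {1..n})])"
| "handler_sends n i j (WriteTag r) s = [(EchoTag r, {1..n}), (WriteAck r, {j})]"
| "handler_sends n i j (ReadTag q) s = [(ReadAck q (max_tag s), {j})]"
| "handler_sends n i j _ s = []"

text \<open>
  \<open>chan \<sigma> i j\<close> is the FIFO queue of undelivered messages from \<open>i\<close> to \<open>j\<close>, each with the time
  at which it was sent.
\<close>

record 'v config =
  nstate :: "node \<Rightarrow> 'v node_state"
  chan :: "node \<Rightarrow> node \<Rightarrow> ('v msg \<times> real) list"
  crashed :: "node set"
  now :: real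

definition init_config :: "'v config" where
  "init_config = \<lparr>nstate = (\<lambda>_. init_node), chan = (\<lambda>_ _. []), crashed = {}, now = 0\<rparr>"

definition put ::
  "real \<Rightarrow> node \<Rightarrow> 'v sends \<Rightarrow> (node \<Rightarrow> node \<Rightarrow> ('v msg \<times> real) list)
     \<Rightarrow> (node \<Rightarrow> node \<Rightarrow> ('v msg \<times> real) list)" where
  "put t i outs ch =
     ch(i := (\<lambda>j. ch i j @ map (\<lambda>(m, J). (m, t)) (filter (\<lambda>(m, J). j \<in> J) outs)))"

text \<open>
  \<open>node_action n f i \<sigma> ch s' outs\<close>: in \<open>\<sigma>\<close>, node \<open>i\<close> can execute an atomic action that leads to
  its local state \<open>s'\<close> and sends \<open>outs\<close>; \<open>ch\<close> are the channels before these sends. The side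
  condition of \<open>receive\<close> makes Lattice evaluate its exit at the first moment at which
  EQ is true; all other local steps may interleave with handlers.
\<close>

inductive node_action ::
  "nat \<Rightarrow> nat \<Rightarrow> node \<Rightarrow> 'v config \<Rightarrow> (node \<Rightarrow> node \<Rightarrow> ('v msg \<times> real) list)
     \<Rightarrow> 'v node_state \<Rightarrow> 'v sends \<Rightarrow> bool"
  for n f i \<sigma> where
  invoke:
    "pc (nstate \<sigma> i) = Idle \<Longrightarrow>
     node_action n f i \<sigma> (chan \<sigma>) ((nstate \<sigma> i)\<lparr>pc := CallRead, pending := Some opn\<rparr>) []"
| local:
    "local_step n f i (nstate \<sigma> i) s' outs \<Longrightarrow> node_action n f i \<sigma> (chan \<sigma>) s' outs"
| receive:
    "\<lbrakk>chan \<sigma> j i = (m, t) # ms;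
      \<not> (\<exists>p r. pc (nstate \<sigma> i) = WaitEQ p r \<and> eq_holds n f i r (nstate \<sigma> i))\<rbrakk> \<Longrightarrow>
     node_action n f i \<sigma> ((chan \<sigma>)(j := (chan \<sigma> j)(i := ms)))
       (handle i j m (nstate \<sigma> i)) (handler_sends n i j m (nstate \<sigma> i))"

text \<open>
  In \<open>act_crash\<close> the node crashes while executing the send command number \<open>c\<close> of an action, which
  is completed only for the destinations in \<open>S\<close>. In \<open>pass\<close>, time may not advance while some
  live node can execute a local step (local computation takes no time), nor beyond \<open>D\<close> after the
  sending of a message still undelivered to a live node.
\<close>

inductive step :: "nat \<Rightarrow> nat \<Rightarrow> real \<Rightarrow> 'v config \<Rightarrow> 'v config \<Rightarrow> bool"
  for n f D where
  act:
    "\<lbrakk>i \<in> {1..n}; i \<notin> crashed \<sigma>; node_action n f i \<sigma> ch s' outs\<rbrakk> \<Longrightarrow>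
     step n f D \<sigma> (\<sigma>\<lparr>nstate := (nstate \<sigma>)(i := s'), chan := put (now \<sigma>) i outs ch\<rparr>)"
| act_crash:
    "\<lbrakk>i \<in> {1..n}; i \<notin> crashed \<sigma>; node_action n f i \<sigma> ch s' outs;
      c < length outs; outs ! c = (m, J); S \<subseteq> J\<rbrakk> \<Longrightarrow>
     step n f D \<sigma> (\<sigma>\<lparr>nstate := (nstate \<sigma>)(i := s'),
       chan := put (now \<sigma>) i (take c outs @ [(m, S)]) ch,
       crashed := insert i (crashed \<sigma>)\<rparr>)"
| crash:
    "\<lbrakk>i \<in> {1..n}; i \<notin> crashed \<sigma>\<rbrakk> \<Longrightarrow> step n f D \<sigma> (\<sigma>\<lparr>crashed := insert i (crashed \<sigma>)\<rparr>)"
| pass: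
    "\<lbrakk>now \<sigma> \<le> t;
      \<And>i s' outs. \<lbrakk>i \<in> {1..n}; i \<notin> crashed \<sigma>\<rbrakk> \<Longrightarrow> \<not> local_step n f i (nstate \<sigma> i) s' outs;
      \<And>i j m u. \<lbrakk>i \<in> {1..n}; j \<in> {1..n}; j \<notin> crashed \<sigma>; (m, u) \<in> set (chan \<sigma> i j)\<rbrakk>
        \<Longrightarrow> t \<le> u + D\<rbrakk> \<Longrightarrow>
     step n f D \<sigma> (\<sigma>\<lparr>now := t\<rparr>)"

definition faulty :: "(nat \<Rightarrow> 'v config) \<Rightarrow> node set" where
  "faulty \<rho> = (\<Union>m. crashed (\<rho> m))"

definition execution :: "nat \<Rightarrow> nat \<Rightarrow> real \<Rightarrow> (nat \<Rightarrow> 'v config) \<Rightarrow> bool" where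
  "execution n f D \<rho> \<longleftrightarrow>
     \<rho> 0 = init_config \<and> (\<forall>m. step n f D (\<rho> m) (\<rho> (Suc m))) \<and>
     filterlim (\<lambda>m. now (\<rho> m)) at_top sequentially \<and> card (faulty \<rho>) \<le> f"

definition lattice_starts :: "(nat \<Rightarrow> 'v config) \<Rightarrow> node \<Rightarrow> nat \<Rightarrow> nat \<Rightarrow> bool" where
  "lattice_starts \<rho> i r a \<longleftrightarrow>
     (\<exists>p. pc (nstate (\<rho> a) i) = CallLattice p r \<and> pc (nstate (\<rho> (Suc a)) i) = WaitWrite p r)"

definition lattice_returns :: "(nat \<Rightarrow> 'v config) \<Rightarrow> node \<Rightarrow> nat \<Rightarrow> nat \<Rightarrow> bool" where
  "lattice_returns \<rho> i r b \<longleftrightarrow>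
     (\<exists>p status view. pc (nstate (\<rho> b) i) = WaitEQ p r \<and>
        pc (nstate (\<rho> (Suc b)) i) = LatticeDone p r status view)"

text \<open>The call of Lattice with tag \<open>r\<close> that starts at node \<open>i\<close> in step \<open>a\<close> returns in step \<open>b\<close>.\<close>

definition lattice_completes :: "(nat \<Rightarrow> 'v config) \<Rightarrow> node \<Rightarrow> nat \<Rightarrow> nat \<Rightarrow> nat \<Rightarrow> bool" where
  "lattice_completes \<rho> i r a b \<longleftrightarrow>
     lattice_starts \<rho> i r a \<and> a < b \<and> lattice_returns \<rho> i r b \<and>
     (\<forall>m r'. a < m \<and> m < b \<longrightarrow> \<not> lattice_returns \<rho> i r' m)"

text \<open>
  The call that starts in step \<open>a\<close> takes at most \<open>x\<close> message delays: it completes within time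
  \<open>x * D\<close>, unless its node crashes within that time.
\<close>

definition takes_at_most ::
  "real \<Rightarrow> (nat \<Rightarrow> 'v config) \<Rightarrow> node \<Rightarrow> nat \<Rightarrow> nat \<Rightarrow> real \<Rightarrow> bool" where
  "takes_at_most D \<rho> i r a x \<longleftrightarrow>
     (\<exists>b. now (\<rho> b) \<le> now (\<rho> a) + x * D \<and>
        (lattice_completes \<rho> i r a b \<or> i \<in> crashed (\<rho> b)))"

end

theory Submission
  imports Defs
begin

text \<open>
  Within two message delays the call has written its tag \<open>r\<close> to a quorum, and two message delays
  later every readTag that could still return less than \<open>r\<close> has ended; from then on no new value
  with tag at most \<open>r\<close> is created. While EQ remains false at \<open>i\<close>, every interval of two message
  delays brings \<open>i\<close> a value with tag at most \<open>r\<close> for the first time, since a value that \<open>i\<close> has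
  forwarded comes back from all nonfaulty nodes within that time. A value that is still on its way
  to \<open>i\<close> after \<open>s\<close> message delays has made about \<open>s\<close> nodes crash in the middle of broadcasting it,
  one in each message delay. A node crashes in at most one broadcast, so these sets of nodes are
  disjoint for different values. With \<open>M\<close> such values the number of crashes is at least
  \<open>1 + 3 + \<dots> + (2 M - 1) = M\<^sup>2\<close>.
\<close>

section \<open>Single steps and what they change\<close>

lemma put_apply:
  "put t i outs ch q l =
     (if q = i then ch i l @ map (\<lambda>(m, J). (m, t)) (filter (\<lambda>(m, J). l \<in> J) outs) else ch q l)"
  by (auto simp: put_def)

text \<open>
  A step in which \<open>p\<close> acts; if \<open>p\<close> crashes in it, \<open>outs\<close> still lists all the sends of the action, of
  which only some are completed.
\<close>

definition transition ::
  "nat \<Rightarrow> nat \<Rightarrow> 'v config \<Rightarrow> 'v config \<Rightarrow> node \<Rightarrow> 'v sends \<Rightarrow> bool" where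
  "transition n f \<sigma> \<sigma>' p outs \<longleftrightarrow>
     p \<in> {1..n} \<and> p \<notin> crashed \<sigma> \<and> (\<exists>ch. node_action n f p \<sigma> ch (nstate \<sigma>' p) outs) \<and>
     (\<forall>q. q \<noteq> p \<longrightarrow> nstate \<sigma>' q = nstate \<sigma> q) \<and> now \<sigma>' = now \<sigma> \<and>
     (p \<notin> crashed \<sigma>' \<longrightarrow>
       (\<forall>m J l. (m, J) \<in> set outs \<longrightarrow> l \<in> J \<longrightarrow> (m, now \<sigma>) \<in> set (chan \<sigma>' p l))) \<and>
     (\<forall>q l m u. (m, u) \<in> set (chan \<sigma>' q l) \<longrightarrow>
       (m, u) \<in> set (chan \<sigma> q l) \<or> q = p \<and> u = now \<sigma> \<and> (\<exists>J. (m, J) \<in> set outs \<and> l \<in> J)) \<and>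
     (\<forall>q l m u. (m, u) \<in> set (chan \<sigma> q l) \<longrightarrow>
       (m, u) \<in> set (chan \<sigma>' q l) \<or>
       l = p \<and> nstate \<sigma>' p = handle p q m (nstate \<sigma> p) \<and>
         outs = handler_sends n p q m (nstate \<sigma> p))"

text \<open>Only \<open>receive\<close> takes an entry out of a channel, and its handler then
  determines the whole action. Sends are added afterwards by \<open>put\<close>, so
  \<open>ch\<close> contains nothing new.\<close>

lemma node_action_chan:
  assumes "node_action n f p \<sigma> ch s' outs"
  shows "set (ch q l) \<subseteq> set (chan \<sigma> q l)"
    and "(m, u) \<in> set (chan \<sigma> q l) \<Longrightarrow> (m, u) \<in> set (ch q l) \<or>
      l = p \<and> s' = handle p q m (nstate \<sigma> p) \<and> outs = handler_sends n p q m (nstate \<sigma> p)"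
  using assms by (cases; auto split: if_splits)+

text \<open>Treats completed and interrupted actions alike: \<open>outs'\<close> lists the sends
  carried out, each to a subset of the destinations of a send in \<open>outs\<close>. For
  \<open>act_crash\<close> it is a proper prefix of \<open>outs\<close> followed by the send that
  was cut off.\<close>

lemma transitionI:
  assumes act: "node_action n f p \<sigma> ch s' outs" and p: "p \<in> {1..n}" "p \<notin> crashed \<sigma>"
    and now: "now \<sigma>' = now \<sigma>" and st: "nstate \<sigma>' = (nstate \<sigma>)(p := s')" and ch: "chan \<sigma>' = put (now \<sigma>) p outs' ch"
    and sub: "\<And>m J. (m, J) \<in> set outs' \<Longrightarrow> \<exists>J'. J \<subseteq> J' \<and> (m, J') \<in> set outs"
    and live: "p \<notin> crashed \<sigma>' \<Longrightarrow> outs' = outs"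
  shows "transition n f \<sigma> \<sigma>' p outs"
proof -
  have new: "(m, u) \<in> set (chan \<sigma> q l) \<or> q = p \<and> u = now \<sigma> \<and> (\<exists>J. (m, J) \<in> set outs \<and> l \<in> J)"
    if m: "(m, u) \<in> set (chan \<sigma>' q l)" for m u q l
  proof (cases "(m, u) \<in> set (ch q l)")
    case True
    then show ?thesis using node_action_chan(1)[OF act] by blast
  next
    case False
    then obtain J where "q = p" "u = now \<sigma>" "(m, J) \<in> set outs'" "l \<in> J"
      using m by (auto simp: ch put_apply split: if_splits)
    then show ?thesis using sub by blast
  qed
  have old: "(m, u) \<in> set (chan \<sigma>' q l) \<or>
       l = p \<and> nstate \<sigma>' p = handle p q m (nstate \<sigma> p) \<and> outs = handler_sends n p q m (nstate \<sigma> p)"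
    if "(m, u) \<in> set (chan \<sigma> q l)" for m u q l
    using node_action_chan(2)[OF act that] by (auto simp: ch st put_apply)
  have "(m, now \<sigma>) \<in> set (chan \<sigma>' p l)" if "p \<notin> crashed \<sigma>'" "(m, J) \<in> set outs" "l \<in> J" for m J l
    using that live by (force simp: ch put_apply)
  then show ?thesis
    unfolding transition_def using act p now st new old by auto
qed

lemma step_cases [consumes 1, case_names quiet transition]:
  assumes "step n f D \<sigma> \<sigma>'"
  obtains "nstate \<sigma>' = nstate \<sigma>" "chan \<sigma>' = chan \<sigma>"
  | p outs where "transition n f \<sigma> \<sigma>' p outs"
  using assms
proof cases
  case (act i ch s' outs)
  then have "transition n f \<sigma> \<sigma>' i outs" by (intro transitionI[where outs' = outs]) auto
  then show ?thesis using that by blast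
next
  case (act_crash i ch s' outs c m J S)
  then have "transition n f \<sigma> \<sigma>' i outs"
    by (intro transitionI[where outs' = "take c outs @ [(m, S)]"])
      (auto dest: in_set_takeD, metis nth_mem)
  then show ?thesis using that by blast
qed (use that in auto)

lemma step_mono:
  assumes "step n f D \<sigma> \<sigma>'"
  shows "now \<sigma> \<le> now \<sigma>'" "crashed \<sigma> \<subseteq> crashed \<sigma>'" "crashed \<sigma>' \<subseteq> crashed \<sigma> \<union> {1..n}"
  using assms by (cases; auto)+

lemma transition_state_cases [consumes 1, case_names same invoke local receive]:
  assumes "transition n f \<sigma> \<sigma>' p outs"
  obtains "q \<noteq> p" "nstate \<sigma>' q = nstate \<sigma> q"
  | opn where "q = p" "pc (nstate \<sigma> p) = Idle" "outs = []"
      "nstate \<sigma>' p = (nstate \<sigma> p)\<lparr>pc := CallRead, pending := Some opn\<rparr>"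
  | "q = p" "local_step n f p (nstate \<sigma> p) (nstate \<sigma>' p) outs"
  | j m u where "q = p" "(m, u) \<in> set (chan \<sigma> j p)"
      "nstate \<sigma>' p = handle p j m (nstate \<sigma> p)" "outs = handler_sends n p j m (nstate \<sigma> p)"
proof (cases "q = p")
  case False
  then show ?thesis using assms that(1) by (auto simp: transition_def)
next
  case True
  obtain ch where "node_action n f p \<sigma> ch (nstate \<sigma>' p) outs"
    using assms by (auto simp: transition_def)
  then show ?thesis
  proof cases
    case (receive j m t ms)
    then show ?thesis using that(4)[of m t j] True by simp
  qed (use that True in auto)
qed

text \<open>Passing time, a crash without an action and actions of other nodes all fall under
  \<open>same\<close>, which leaves three ways for \<open>q\<close> to change.\<close>

lemma step_state_cases [consumes 1, case_names same invoke local receive]: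
  assumes "step n f D \<sigma> \<sigma>'"
  obtains "nstate \<sigma>' q = nstate \<sigma> q"
  | opn where "transition n f \<sigma> \<sigma>' q []" "pc (nstate \<sigma> q) = Idle"
      "nstate \<sigma>' q = (nstate \<sigma> q)\<lparr>pc := CallRead, pending := Some opn\<rparr>"
  | outs where "transition n f \<sigma> \<sigma>' q outs" "local_step n f q (nstate \<sigma> q) (nstate \<sigma>' q) outs"
  | j m u where "transition n f \<sigma> \<sigma>' q (handler_sends n q j m (nstate \<sigma> q))"
      "(m, u) \<in> set (chan \<sigma> j q)" "nstate \<sigma>' q = handle q j m (nstate \<sigma> q)"
  using assms
proof (cases rule: step_cases)
  case (transition p outs)
  from transition show ?thesis
    by (cases rule: transition_state_cases[where q = q]) (use that transition in auto)
qed (use that in auto)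

lemma local_step_frame:
  assumes "local_step n f i s s' outs"
  shows "vals s' = vals s" "max_tag s' = max_tag s" "read_acks s' = read_acks s"
    "read_no s \<le> read_no s'" "write_acks s' \<subseteq> write_acks s"
    "pc s = WaitWrite p r \<Longrightarrow> write_acks s' = write_acks s"
    "pc s' = WaitRead \<Longrightarrow> read_no s < read_no s'"
    "pc s = WaitWrite p r \<Longrightarrow> pc s' = WaitEQ p r"
    "pc s = WaitEQ p r \<Longrightarrow> \<exists>status view. pc s' = LatticeDone p r status view"
    "pc s' = WaitEQ p r \<Longrightarrow> n - f \<le> card (write_ackers r s)"
    "pc s' = WaitRead \<Longrightarrow> (ReadTag (read_no s'), {1..n}) \<in> set outs"
    "pc s' = WaitWrite p r \<Longrightarrow> (WriteTag r, {1..n}) \<in> set outs"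
    "pending s \<noteq> None \<Longrightarrow> pc s' \<noteq> Idle \<Longrightarrow> pending s' \<noteq> None"
  using assms by (cases; auto)+

lemma handle_frame:
  "pc (handle i j m s) = pc s" "pending (handle i j m s) = pending s"
  "read_no (handle i j m s) = read_no s"
  "vals s l \<subseteq> vals (handle i j m s) l" "max_tag s \<le> max_tag (handle i j m s)"
  "read_acks s \<subseteq> read_acks (handle i j m s)" "write_acks s \<subseteq> write_acks (handle i j m s)"
  by (cases m; auto)+

lemma step_state_mono:
  assumes "step n f D \<sigma> \<sigma>'"
  shows "vals (nstate \<sigma> q) l \<subseteq> vals (nstate \<sigma>' q) l"
    and "max_tag (nstate \<sigma> q) \<le> max_tag (nstate \<sigma>' q)"
    and "read_acks (nstate \<sigma> q) \<subseteq> read_acks (nstate \<sigma>' q)"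
    and "read_no (nstate \<sigma> q) \<le> read_no (nstate \<sigma>' q)"
  using assms
  by (cases rule: step_state_cases[where q = q]; simp add: local_step_frame handle_frame)+

text \<open>A value is sent by an UPDATE whose readTag has just ended or by a node that sees it for
  the first time. Either action consists of this one broadcast, so a crash interrupts the broadcast
  of at most one value.\<close>

lemma transition_sends_value:
  assumes "transition n f \<sigma> \<sigma>' p outs" and "(Value x, J) \<in> set outs"
  obtains (originate) v where "outs = [(Value x, {1..n})]" "pc (nstate \<sigma> p) = WaitRead"
      "n - f \<le> card (read_ackers (nstate \<sigma> p))"
      "x = (v, (read_result (nstate \<sigma> p) + 1, p))"
  | (forward) j u where "outs = [(Value x, {1..n})]" "(Value x, u) \<in> set (chan \<sigma> j p)"
      "x \<notin> vals (nstate \<sigma> p) p"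
  using assms(1)
proof (cases rule: transition_state_cases[where q = p])
  case local
  from local(2) show ?thesis by cases (use assms(2) that(1) in auto)
next
  case (receive j m u)
  then show ?thesis using assms(2) that(2) by (cases m) (auto split: if_splits)
qed (use assms(2) in auto)


text \<open>Only \<open>pass\<close> moves the clock, so its side conditions hold whenever time
  really advances.\<close>

lemma step_advancing_time:
  assumes "step n f D \<sigma> \<sigma>'" and "now \<sigma> < now \<sigma>'"
  shows "\<lbrakk>i \<in> {1..n}; i \<notin> crashed \<sigma>\<rbrakk> \<Longrightarrow> \<not> local_step n f i (nstate \<sigma> i) s' outs"
    and "\<lbrakk>i \<in> {1..n}; j \<in> {1..n}; j \<notin> crashed \<sigma>; (m, u) \<in> set (chan \<sigma> i j)\<rbrakk> \<Longrightarrow> now \<sigma>' \<le> u + D"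
  using assms by (cases; force)+

text \<open>Acknowledgements go back to the sender of a request; the assumption on nonempty channels
  makes that sender a node. \<open>chan_wf\<close> supplies it by induction.\<close>

lemma node_action_dest:
  assumes "node_action n f p \<sigma> ch s' outs" "p \<in> {1..n}" "(m, J) \<in> set outs"
    and "\<And>j l. chan \<sigma> j l \<noteq> [] \<Longrightarrow> j \<in> {1..n}"
  shows "J \<subseteq> {1..n}"
  using assms(1)
proof cases
  case local
  from local(2) show ?thesis by cases (use assms in auto)
next
  case (receive j m' t ms)
  then have "j \<in> {1..n}" using assms(4)[of j p] by simp
  then show ?thesis using receive assms(3) by (cases m') (auto split: if_splits)
qed (use assms in auto)

lemma first_change:
  assumes "\<not> P a" "P b" "a \<le> (b :: nat)"
  obtains k where "a \<le> k" "k < b" "\<not> P k" "P (Suc k)"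
proof (rule ccontr)
  assume none: "\<not> thesis"
  have "\<not> P b" using \<open>a \<le> b\<close>
  proof (induction rule: dec_induct)
    case (step k)
    then show ?case using none that by blast
  qed (rule assms(1))
  then show False using assms(2) by simp
qed

section \<open>Monotone quantities along an execution\<close>

locale exec =
  fixes n f :: nat and D :: real and \<rho> :: "nat \<Rightarrow> 'v config"
  assumes majority: "2 * f < n" and D_pos: "0 < D" and exec: "execution n f D \<rho>"
begin

abbreviation state :: "nat \<Rightarrow> node \<Rightarrow> 'v node_state" where
  "state m \<equiv> nstate (\<rho> m)"

lemma run_start: "\<rho> 0 = init_config"
  and run_step: "step n f D (\<rho> m) (\<rho> (Suc m))"
  and run_time: "filterlim (\<lambda>m. now (\<rho> m)) at_top sequentially"
  and card_faulty: "card (faulty \<rho>) \<le> f"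
  using exec by (auto simp: execution_def)

lemma now_mono: "m \<le> m' \<Longrightarrow> now (\<rho> m) \<le> now (\<rho> m')"
  by (rule lift_Suc_mono_le[where f = "\<lambda>m. now (\<rho> m)"]) (auto intro: step_mono[OF run_step])

lemma crashed_mono: "m \<le> m' \<Longrightarrow> crashed (\<rho> m) \<subseteq> crashed (\<rho> m')"
  by (rule lift_Suc_mono_le[where f = "\<lambda>m. crashed (\<rho> m)"]) (intro step_mono[OF run_step])

lemma vals_mono: "m \<le> m' \<Longrightarrow> vals (state m q) l \<subseteq> vals (state m' q) l"
  by (rule lift_Suc_mono_le[where f = "\<lambda>m. vals (state m q) l"])
    (intro step_state_mono[OF run_step])

lemma max_tag_mono: "m \<le> m' \<Longrightarrow> max_tag (state m q) \<le> max_tag (state m' q)"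
  by (rule lift_Suc_mono_le[where f = "\<lambda>m. max_tag (state m q)"])
    (intro step_state_mono[OF run_step])

lemma read_acks_mono: "m \<le> m' \<Longrightarrow> read_acks (state m q) \<subseteq> read_acks (state m' q)"
  by (rule lift_Suc_mono_le[where f = "\<lambda>m. read_acks (state m q)"])
    (intro step_state_mono[OF run_step])

lemma read_no_mono: "m \<le> m' \<Longrightarrow> read_no (state m q) \<le> read_no (state m' q)"
  by (rule lift_Suc_mono_le[where f = "\<lambda>m. read_no (state m q)"])
    (intro step_state_mono[OF run_step])

lemma crashed_nodes: "crashed (\<rho> m) \<subseteq> {1..n}"
proof (induction m)
  case 0
  show ?case by (simp add: run_start init_config_def)
next
  case (Suc m)
  then show ?case using step_mono(3)[OF run_step[of m]] by auto
qed

lemma faulty_nodes: "faulty \<rho> \<subseteq> {1..n}"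
  using crashed_nodes by (auto simp: faulty_def)

lemma finite_faulty: "finite (faulty \<rho>)"
  using faulty_nodes finite_subset by blast

lemma card_nonfaulty: "n - f \<le> card ({1..n} - faulty \<rho>)"
  using card_Diff_subset[OF finite_faulty faulty_nodes] card_faulty by simp

lemma not_faulty: "q \<notin> faulty \<rho> \<Longrightarrow> q \<notin> crashed (\<rho> m)"
  by (auto simp: faulty_def)

lemma chan_wf:
  assumes "(m, u) \<in> set (chan (\<rho> k) p q)"
  shows "p \<in> {1..n}" "q \<in> {1..n}" "u \<le> now (\<rho> k)"
proof -
  have "\<forall>p q m u. (m, u) \<in> set (chan (\<rho> k) p q) \<longrightarrow> p \<in> {1..n} \<and> q \<in> {1..n} \<and> u \<le> now (\<rho> k)"
  proof (induction k)
    case 0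
    show ?case by (simp add: run_start init_config_def)
  next
    case (Suc k)
    have le: "now (\<rho> k) \<le> now (\<rho> (Suc k))" by (simp add: now_mono)
    have src: "j \<in> {1..n}" if "chan (\<rho> k) j l \<noteq> []" for j l
      using Suc that by (metis last_in_set surj_pair)
    from run_step[of k] show ?case
    proof (cases rule: step_cases)
      case quiet
      then show ?thesis using Suc le by fastforce
    next
      case (transition p outs)
      then obtain ch where "node_action n f p (\<rho> k) ch (state (Suc k) p) outs" "p \<in> {1..n}"
        by (auto simp: transition_def)
      then have "J \<subseteq> {1..n}" if "(m, J) \<in> set outs" for m J
        using node_action_dest that src by meson
      then show ?thesis
        using transition Suc le unfolding transition_def by (smt (verit) subsetD)
    qed
  qed
  then show "p \<in> {1..n}" "q \<in> {1..n}" "u \<le> now (\<rho> k)" using assms by auto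
qed

section \<open>Points in time and timely delivery\<close>

text \<open>\<open>at_time T\<close> is the last index at time at most \<open>T\<close>; the step taken from it advances the clock.\<close>

definition at_time :: "real \<Rightarrow> nat" where
  "at_time T = (LEAST m. T < now (\<rho> (Suc m)))"

lemma at_time_Suc: "T < now (\<rho> (Suc (at_time T)))"
proof -
  have "eventually (\<lambda>m. T < now (\<rho> m)) sequentially"
    using run_time by (simp add: filterlim_at_top_dense)
  then obtain M where "\<forall>m\<ge>M. T < now (\<rho> m)" by (auto simp: eventually_sequentially)
  then have "T < now (\<rho> (Suc M))" by simp
  then show ?thesis unfolding at_time_def by (rule LeastI)
qed

lemma now_at_time: "0 \<le> T \<Longrightarrow> now (\<rho> (at_time T)) \<le> T"
proof (cases "at_time T")
  case 0
  then show "0 \<le> T \<Longrightarrow> ?thesis" by (simp add: run_start init_config_def)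
next
  case (Suc m)
  then have "\<not> T < now (\<rho> (Suc m))"
    unfolding at_time_def by (metis lessI not_less_Least)
  then show ?thesis using Suc by simp
qed

lemma le_at_time: "now (\<rho> m) \<le> T \<Longrightarrow> m \<le> at_time T"
  using at_time_Suc[of T] now_mono[of "Suc (at_time T)" m] by force

lemma at_time_mono: "0 \<le> S \<Longrightarrow> S \<le> T \<Longrightarrow> at_time S \<le> at_time T"
  using le_at_time now_at_time order_trans by blast

lemma now_nonneg: "0 \<le> now (\<rho> m)"
  using now_mono[of 0 m] by (simp add: run_start init_config_def)

text \<open>The step from \<open>at_time T\<close> crosses time \<open>T\<close>, so it is a
  \<open>pass\<close>: local computation has settled, and the new clock value, which exceeds
  \<open>T\<close>, is at most \<open>u + D\<close> for every entry still on its way to a live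
  node.\<close>

lemma at_time_quiescent:
  assumes "0 \<le> T" "q \<in> {1..n}" "q \<notin> crashed (\<rho> (at_time T))"
  shows "\<not> local_step n f q (state (at_time T) q) s' outs"
    and "(m, u) \<in> set (chan (\<rho> (at_time T)) p q) \<Longrightarrow> T < u + D"
proof -
  have less: "now (\<rho> (at_time T)) < now (\<rho> (Suc (at_time T)))"
    using at_time_Suc[of T] now_at_time[OF assms(1)] by simp
  show "\<not> local_step n f q (state (at_time T) q) s' outs"
    using step_advancing_time(1)[OF run_step less] assms by blast
  show "T < u + D" if "(m, u) \<in> set (chan (\<rho> (at_time T)) p q)"
    using step_advancing_time(2)[OF run_step less _ _ _ that] chan_wf[OF that] assms at_time_Suc[of T]
    by force
qed

text \<open>An entry leaves a channel only by being handled, and at \<open>at_time T\<close> no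
  entry sent at time \<open>T - D\<close> or earlier is still waiting for a live node.\<close>

lemma delivery:
  assumes "(x, u) \<in> set (chan (\<rho> a) p q)" "q \<notin> crashed (\<rho> (at_time T))"
    and "u + D \<le> T" "0 \<le> T" "a \<le> at_time T"
  obtains k where "a \<le> k" "k < at_time T"
    "transition n f (\<rho> k) (\<rho> (Suc k)) q (handler_sends n q p x (state k q))"
    "state (Suc k) q = handle q p x (state k q)" "(x, u) \<in> set (chan (\<rho> k) p q)"
proof -
  have q: "q \<in> {1..n}" using chan_wf assms(1) by blast
  have "(x, u) \<in> set (chan (\<rho> b) p q) \<or> (\<exists>k. a \<le> k \<and> k < b \<and>
      transition n f (\<rho> k) (\<rho> (Suc k)) q (handler_sends n q p x (state k q)) \<and>
      state (Suc k) q = handle q p x (state k q) \<and> (x, u) \<in> set (chan (\<rho> k) p q))"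
    if "a \<le> b" for b
    using that
  proof (induction b rule: dec_induct)
    case base
    then show ?case using assms(1) by simp
  next
    case (step b)
    show ?case
    proof (cases "(x, u) \<in> set (chan (\<rho> b) p q)")
      case True
      from run_step[of b] show ?thesis
      proof (cases rule: step_cases)
        case quiet
        then show ?thesis using True by simp
      next
        case (transition i outs)
        then have "(x, u) \<in> set (chan (\<rho> (Suc b)) p q) \<or>
            q = i \<and> state (Suc b) i = handle i p x (state b i) \<and>
            outs = handler_sends n i p x (state b i)"
          using True unfolding transition_def by blast
        then show ?thesis using transition True step(1) by auto
      qed
    next
      case False
      then show ?thesis using step less_SucI by blast
    qed
  qed
  from this[OF assms(5)] show ?thesis
    using at_time_quiescent(2)[OF assms(4) q assms(2)] assms(3) that by fastforce
qed

lemma sent: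
  assumes "transition n f (\<rho> k) (\<rho> (Suc k)) p outs" "(x, J) \<in> set outs" "q \<in> J"
    "p \<notin> crashed (\<rho> (Suc k))"
  shows "(x, now (\<rho> k)) \<in> set (chan (\<rho> (Suc k)) p q)"
  using assms unfolding transition_def by blast

text \<open>Two deliveries in a row. The answer \<open>y s\<close> depends on the state of the
  responder because a \<open>ReadAck\<close> carries its current \<open>max_tag\<close>; for
  writeTag it is constant.\<close>

lemma round_trip:
  assumes req: "transition n f (\<rho> a) (\<rho> (Suc a)) p outs" "(x, J) \<in> set outs" "j \<in> J"
    and j: "j \<notin> faulty \<rho>"
    and resp: "\<And>s. \<exists>J. (y s, J) \<in> set (handler_sends n j p x s) \<and> p \<in> J"
    and T: "now (\<rho> a) + 2 * D \<le> T" and p: "p \<notin> crashed (\<rho> (at_time T))"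
  obtains k s where "a < k" "k < at_time T" "state (Suc k) p = handle p j (y s) (state k p)"
proof -
  \<comment> \<open>Deadline for the request; the answer then has one more message delay.\<close>
  define T1 where "T1 = now (\<rho> a) + D"
  have T1: "0 \<le> T1" "T1 + D \<le> T" "T1 \<le> T" using T now_nonneg[of a] D_pos by (auto simp: T1_def)
  have "now (\<rho> (Suc a)) = now (\<rho> a)" using req(1) by (simp add: transition_def)
  then have a1: "Suc a \<le> at_time T1" using D_pos by (intro le_at_time) (simp add: T1_def)
  have T1T: "at_time T1 \<le> at_time T" using T1 by (intro at_time_mono)
  have "p \<notin> crashed (\<rho> (Suc a))" using crashed_mono[of "Suc a" "at_time T"] a1 T1T p by auto
  note chan1 = sent[OF req this]
  obtain k1 where k1: "Suc a \<le> k1" "k1 < at_time T1"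
      "transition n f (\<rho> k1) (\<rho> (Suc k1)) j (handler_sends n j p x (state k1 j))"
    using delivery[OF chan1 not_faulty[OF j] _ T1(1) a1] by (auto simp: T1_def)
  obtain K where K: "(y (state k1 j), K) \<in> set (handler_sends n j p x (state k1 j))" "p \<in> K"
    using resp by blast
  have "now (\<rho> k1) \<le> T1" using now_mono[of k1 "at_time T1"] now_at_time[OF T1(1)] k1(2) by simp
  then have "now (\<rho> k1) + D \<le> T" "0 \<le> T" "Suc k1 \<le> at_time T" using T1 k1(2) T1T by auto
  note delivery[OF sent[OF k1(3) K not_faulty[OF j]] p this]
  then obtain k where "Suc k1 \<le> k" "k < at_time T"
      "state (Suc k) p = handle p j (y (state k1 j)) (state k p)" by metis
  then show ?thesis using that[of k "state k1 j"] k1(1) by simp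
qed

section \<open>The write phase and its quorum\<close>

text \<open>The handler that sends \<open>WriteAck r\<close> raises \<open>max_tag\<close> to at
  least \<open>r\<close> in the same action, and \<open>max_tag\<close> never decreases.\<close>

lemma write_acks_sound:
  "(WriteAck r, u) \<in> set (chan (\<rho> k) j i) \<Longrightarrow> r \<le> max_tag (state k j)"
  "(j, r) \<in> write_acks (state k i) \<Longrightarrow> j \<in> {1..n} \<and> r \<le> max_tag (state k j)"
proof (induction k arbitrary: i j r u)
  case 0
  {
    case 1
    then show ?case by (simp add: run_start init_config_def)
  next
    case 2
    then show ?case by (simp add: run_start init_config_def init_node_def)
  }
next
  case (Suc k)
  {
    case 1
    from run_step[of k] show ?case
    proof (cases rule: step_cases)
      case quiet
      then show ?thesis using Suc.IH(1) 1 by simp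
    next
      case (transition p outs)
      consider "(WriteAck r, u) \<in> set (chan (\<rho> k) j i)"
        | J where "j = p" "(WriteAck r, J) \<in> set outs"
        using transition 1 unfolding transition_def by blast
      then show ?thesis
      proof cases
        case 1
        then show ?thesis
          using Suc.IH(1) step_state_mono(2)[OF run_step] order_trans by blast
      next
        case (2 J)
        from transition show ?thesis
        proof (cases rule: transition_state_cases[where q = p])
          case local
          from local(2) show ?thesis by cases (use 2 in auto)
        next
          case (receive l m v)
          then show ?thesis using 2 by (cases m) (auto split: if_splits)
        qed (use 2 in auto)
      qed
    qed
  next
    case 2
    have mono: ?case if "(j, r) \<in> write_acks (state k i)"
      using Suc.IH(2)[OF that] step_state_mono(2)[OF run_step[of k], of j] by auto
    from run_step[of k] show ?case
    proof (cases rule: step_state_cases[where q = i])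
      case (local outs)
      then show ?thesis using mono 2 local_step_frame(5) by blast
    next
      case (receive l m v)
      have "r \<le> max_tag (state (Suc k) l)" if "m = WriteAck r"
        using Suc.IH(1) receive(2) that step_state_mono(2)[OF run_step[of k], of l] order_trans
        by blast
      then show ?thesis using mono 2 receive chan_wf(1)[OF receive(2)] by (cases m) auto
    qed (use mono 2 in auto)
  }
qed

lemma finite_write_ackers: "finite (write_ackers r (state k i))"
  by (rule finite_subset[of _ "{1..n}"]) (auto simp: write_ackers_def dest: write_acks_sound(2))

text \<open>\<open>lattice_call\<close> clears \<open>write_acks\<close>, so monotonicity is
  available only during the wait of one call.\<close>

lemma write_acks_step:
  assumes "pc (state k i) = WaitWrite p r"
  shows "write_acks (state k i) \<subseteq> write_acks (state (Suc k) i)"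
  using run_step[of k]
  by (cases rule: step_state_cases[where q = i])
    (use assms in \<open>auto simp: local_step_frame handle_frame dest: handle_frame(7)[THEN subsetD]\<close>)

text \<open>Were the call still waiting at \<open>at_time T\<close>, the acknowledgements of all
  nonfaulty nodes would have arrived and \<open>write_done\<close> would be enabled, against
  quiescence.\<close>

lemma write_phase:
  assumes call: "transition n f (\<rho> a) (\<rho> (Suc a)) i outs" "(WriteTag r, {1..n}) \<in> set outs"
    and T: "now (\<rho> a) + 2 * D \<le> T" and i: "i \<notin> crashed (\<rho> (at_time T))"
  shows "\<exists>k. a < k \<and> k \<le> at_time T \<and> pc (state k i) \<noteq> WaitWrite p r"
proof (rule ccontr)
  assume "\<not> ?thesis"
  then have pc: "pc (state k i) = WaitWrite p r" if "a < k" "k \<le> at_time T" for k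
    using that by blast
  have T0: "0 \<le> T" using T D_pos now_nonneg[of a] by simp
  have "now (\<rho> (Suc a)) \<le> T" using T D_pos call(1) by (simp add: transition_def)
  then have a: "a < at_time T" using le_at_time[of "Suc a" T] by simp
  have node: "i \<in> {1..n}" using call(1) by (simp add: transition_def)
  have "j \<in> write_ackers r (state (at_time T) i)" if j: "j \<in> {1..n} - faulty \<rho>" for j
  proof -
    have j': "j \<in> {1..n}" "j \<notin> faulty \<rho>" using j by auto
    have resp: "\<exists>J. (WriteAck r, J) \<in> set (handler_sends n j i (WriteTag r) s) \<and> i \<in> J"
      for s :: "'v node_state" by auto
    obtain k where k: "a < k" "k < at_time T" "state (Suc k) i = handle i j (WriteAck r) (state k i)"
      using round_trip[OF call j' resp T i] by metis
    have "(j, r) \<in> write_acks (state m i)" if "Suc k \<le> m" "m \<le> at_time T" for m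
      using that
    proof (induction m rule: dec_induct)
      case base
      then show ?case by (simp add: k(3))
    next
      case (step m)
      then show ?case using write_acks_step[OF pc[of m]] k(1) by auto
    qed
    then show ?thesis using k(2) by (simp add: write_ackers_def)
  qed
  then have "n - f \<le> card (write_ackers r (state (at_time T) i))"
    using card_nonfaulty card_mono[OF finite_write_ackers] by (meson le_trans subsetI)
  then show False
    using at_time_quiescent(1)[OF T0 node i] local_step.write_done pc[OF a] by blast
qed

text \<open>The acknowledgements counted on entering \<open>WaitEQ\<close> come from nodes that know
  the tag, and they keep knowing it. Later readTags have to meet this quorum.\<close>

lemma waiting_quorum:
  "pc (state k i) = WaitEQ p r \<Longrightarrow> n - f \<le> card {j \<in> {1..n}. r \<le> max_tag (state k j)}"
proof (induction k)
  case 0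
  then show ?case by (simp add: run_start init_config_def init_node_def)
next
  case (Suc k)
  have sub: "{j \<in> {1..n}. r \<le> max_tag (state k j)} \<subseteq> {j \<in> {1..n}. r \<le> max_tag (state (Suc k) j)}"
    using max_tag_mono[of k "Suc k"] order_trans by fastforce
  have mono: ?case if "pc (state k i) = WaitEQ p r"
    using Suc.IH[OF that] card_mono[OF _ sub] by simp
  from run_step[of k] show ?case
  proof (cases rule: step_state_cases[where q = i])
    case (local outs)
    then have "n - f \<le> card (write_ackers r (state k i))"
      using local_step_frame(10) Suc.prems by blast
    also have "\<dots> \<le> card {j \<in> {1..n}. r \<le> max_tag (state k j)}"
      by (intro card_mono) (auto simp: write_ackers_def dest: write_acks_sound)
    finally show ?thesis using card_mono[OF _ sub] by simp
  qed (use mono Suc.prems in \<open>auto simp: handle_frame\<close>)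
qed

section \<open>Reads that start late return large tags\<close>

lemma transition_read_messages:
  assumes "transition n f \<sigma> \<sigma>' p outs"
  shows "(ReadTag c, J) \<in> set outs \<Longrightarrow> c \<le> read_no (nstate \<sigma>' p)"
    and "(ReadAck c t, J) \<in> set outs \<Longrightarrow> q \<in> J \<Longrightarrow>
      t = max_tag (nstate \<sigma> p) \<and> (\<exists>u. (ReadTag c, u) \<in> set (chan \<sigma> q p))"
proof -
  have "((ReadTag c, J) \<in> set outs \<longrightarrow> c \<le> read_no (nstate \<sigma>' p)) \<and>
    ((ReadAck c t, J) \<in> set outs \<longrightarrow> q \<in> J \<longrightarrow>
      t = max_tag (nstate \<sigma> p) \<and> (\<exists>u. (ReadTag c, u) \<in> set (chan \<sigma> q p)))"
    using assms
  proof (cases rule: transition_state_cases[where q = p])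
    case local
    from local(2) show ?thesis by cases auto
  next
    case (receive l m v)
    then show ?thesis by (cases m) (auto split: if_splits)
  qed auto
  then show "(ReadTag c, J) \<in> set outs \<Longrightarrow> c \<le> read_no (nstate \<sigma>' p)"
    "(ReadAck c t, J) \<in> set outs \<Longrightarrow> q \<in> J \<Longrightarrow>
      t = max_tag (nstate \<sigma> p) \<and> (\<exists>u. (ReadTag c, u) \<in> set (chan \<sigma> q p))" by auto
qed

lemma read_acks_step:
  assumes "(j, c, t) \<in> read_acks (state (Suc k) q)"
  shows "(j, c, t) \<in> read_acks (state k q) \<or> (\<exists>u. (ReadAck c t, u) \<in> set (chan (\<rho> k) j q))"
  using run_step[of k]
proof (cases rule: step_state_cases[where q = q])
  case (local outs)
  then show ?thesis using assms local_step_frame(3) by blast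
next
  case (receive l m v)
  then show ?thesis using assms by (cases m) auto
qed (use assms in auto)

lemma read_ack_chan_step:
  assumes "(ReadAck c t, u) \<in> set (chan (\<rho> (Suc k)) j q)"
  shows "(ReadAck c t, u) \<in> set (chan (\<rho> k) j q) \<or>
    t = max_tag (state k j) \<and> (\<exists>v. (ReadTag c, v) \<in> set (chan (\<rho> k) q j))"
  using run_step[of k]
proof (cases rule: step_cases)
  case (transition p outs)
  then consider "(ReadAck c t, u) \<in> set (chan (\<rho> k) j q)"
    | J where "j = p" "(ReadAck c t, J) \<in> set outs" "q \<in> J"
    using assms unfolding transition_def by blast
  then show ?thesis by cases (use transition_read_messages(2)[OF transition] in auto)
qed (use assms in auto)

lemma read_tag_chan:
  "(ReadTag c, u) \<in> set (chan (\<rho> k) q j) \<Longrightarrow> c \<le> read_no (state k q)"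
proof (induction k arbitrary: q j c u)
  case 0
  then show ?case by (simp add: run_start init_config_def)
next
  case (Suc k)
  from run_step[of k] show ?case
  proof (cases rule: step_cases)
    case quiet
    then show ?thesis using Suc by simp
  next
    case (transition p outs)
    then consider "(ReadTag c, u) \<in> set (chan (\<rho> k) q j)"
      | J where "q = p" "(ReadTag c, J) \<in> set outs"
      using Suc.prems unfolding transition_def by blast
    then show ?thesis
    proof cases
      case 1
      then show ?thesis using Suc.IH[OF 1] read_no_mono[of k "Suc k" q] by simp
    next
      case 2
      then show ?thesis using transition_read_messages(1)[OF transition] by simp
    qed
  qed
qed

text \<open>An acknowledgement that is neither received nor in transit at \<open>m\<close> is
  created later, from a \<open>max_tag\<close> of \<open>j\<close> that is by then at least
  \<open>r\<close>.\<close>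

lemma fresh_read_ack:
  assumes j: "r \<le> max_tag (state m j)" and c: "read_no (state m q) < c"
    and ack: "(j, c, t) \<in> read_acks (state k q)"
    and init: "(j, c, t) \<notin> read_acks (state m q)" "\<And>u. (ReadAck c t, u) \<notin> set (chan (\<rho> m) j q)"
    and "m \<le> k"
  shows "r \<le> t"
proof (rule ccontr)
  assume t: "\<not> r \<le> t"
  have "(j, c, t) \<notin> read_acks (state k q) \<and> (\<forall>u. (ReadAck c t, u) \<notin> set (chan (\<rho> k) j q))"
    using \<open>m \<le> k\<close>
  proof (induction k rule: dec_induct)
    case base
    then show ?case using init by simp
  next
    case (step k)
    have "t \<noteq> max_tag (state k j)" using max_tag_mono[OF step(1), of j] j t by simp
    then show ?case using step.IH read_acks_step read_ack_chan_step by blast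
  qed
  then show False using ack by simp
qed

text \<open>Shows that no acknowledgement of a call exists before the call begins, which is the
  freshness that \<open>fresh_read_ack\<close> asks for.\<close>

lemma read_acks_wf:
  "(ReadAck c t, u) \<in> set (chan (\<rho> k) j q) \<Longrightarrow> c \<le> read_no (state k q)"
  "(j, c, t) \<in> read_acks (state k q) \<Longrightarrow> j \<in> {1..n} \<and> c \<le> read_no (state k q)"
proof (induction k arbitrary: u)
  case 0
  {
    case 1
    then show ?case by (simp add: run_start init_config_def)
  next
    case 2
    then show ?case by (simp add: run_start init_config_def init_node_def)
  }
next
  case (Suc k)
  have mono: "read_no (state k q) \<le> read_no (state (Suc k) q)" by (simp add: read_no_mono)
  {
    case 1
    then consider "(ReadAck c t, u) \<in> set (chan (\<rho> k) j q)" | v where "(ReadTag c, v) \<in> set (chan (\<rho> k) q j)"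
      using read_ack_chan_step by blast
    then have "c \<le> read_no (state k q)" by cases (auto intro: Suc.IH(1) read_tag_chan)
    then show ?case using mono by simp
  next
    case 2
    then consider "(j, c, t) \<in> read_acks (state k q)" | v where "(ReadAck c t, v) \<in> set (chan (\<rho> k) j q)"
      using read_acks_step by blast
    then show ?case
    proof cases
      case 1
      then show ?thesis using Suc.IH(2) mono by auto
    next
      case (2 v)
      then show ?thesis using Suc.IH(1)[OF 2] chan_wf(1)[OF 2] mono by simp
    qed
  }
qed

lemma finite_read_acks: "finite (read_acks (state k q))"
proof (induction k)
  case 0
  then show ?case by (simp add: run_start init_config_def init_node_def)
next
  case (Suc k)
  from run_step[of k] show ?case
  proof (cases rule: step_state_cases[where q = q])
    case (local outs)
    then show ?thesis using Suc local_step_frame(3) by metis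
  next
    case (receive l m v)
    then show ?thesis using Suc by (cases m) auto
  qed (use Suc in auto)
qed

text \<open>Ensures that a readTag with enough acknowledgements can end by one of the two rules, for
  SCAN or for UPDATE.\<close>

lemma pending_operation: "pc (state k q) \<noteq> Idle \<Longrightarrow> pending (state k q) \<noteq> None"
proof (induction k)
  case 0
  then show ?case by (simp add: run_start init_config_def init_node_def)
next
  case (Suc k)
  from run_step[of k] show ?case
  proof (cases rule: step_state_cases[where q = q])
    case (local outs)
    then have "pc (state k q) \<noteq> Idle" by (auto elim: local_step.cases)
    then show ?thesis using local local_step_frame(13) Suc by blast
  qed (use Suc in \<open>auto simp: handle_frame\<close>)
qed

text \<open>Traces a pending readTag back to the broadcast that opened it, so that both its age and
  the freshness of its acknowledgements can be measured from \<open>a\<close>.\<close>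

lemma read_start:
  assumes "pc (state k q) = WaitRead"
  obtains a outs where "a < k" "transition n f (\<rho> a) (\<rho> (Suc a)) q outs"
    "(ReadTag (read_no (state k q)), {1..n}) \<in> set outs"
    "read_no (state a q) < read_no (state k q)"
    "\<And>b. a < b \<Longrightarrow> b \<le> k \<Longrightarrow> pc (state b q) = WaitRead \<and> read_no (state b q) = read_no (state k q)"
proof -
  have "\<exists>a outs. a < k \<and> transition n f (\<rho> a) (\<rho> (Suc a)) q outs \<and>
    (ReadTag (read_no (state k q)), {1..n}) \<in> set outs \<and>
    read_no (state a q) < read_no (state k q) \<and>
    (\<forall>b. a < b \<and> b \<le> k \<longrightarrow> pc (state b q) = WaitRead \<and> read_no (state b q) = read_no (state k q))"
    using assms
  proof (induction k)
    case 0
    then show ?case by (simp add: run_start init_config_def init_node_def)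
  next
    case (Suc k)
    have extend: ?case if eq: "pc (state k q) = WaitRead" "read_no (state (Suc k) q) = read_no (state k q)"
    proof -
      obtain a outs where a: "a < k" "transition n f (\<rho> a) (\<rho> (Suc a)) q outs"
        "(ReadTag (read_no (state k q)), {1..n}) \<in> set outs"
        "read_no (state a q) < read_no (state k q)"
        and b: "\<forall>b. a < b \<and> b \<le> k \<longrightarrow> pc (state b q) = WaitRead \<and> read_no (state b q) = read_no (state k q)"
        using Suc.IH[OF eq(1)] by (elim exE conjE)
      have "pc (state b q) = WaitRead \<and> read_no (state b q) = read_no (state k q)"
        if "a < b" "b \<le> Suc k" for b
      proof (cases "b = Suc k")
        case True
        then show ?thesis using Suc.prems eq(2) by simp
      next
        case False
        then have "b \<le> k" using that(2) by simp
        then show ?thesis using b that(1) by blast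
      qed
      then show ?thesis unfolding eq(2) using a less_SucI by blast
    qed
    from run_step[of k] show ?case
    proof (cases rule: step_state_cases[where q = q])
      case (local outs)
      then show ?thesis
        using local_step_frame(7,11)[OF local(2) Suc.prems] Suc.prems
        by (intro exI[of _ k] exI[of _ outs] conjI allI impI)
          (use local in \<open>auto simp: le_Suc_eq\<close>)
    qed (use extend Suc.prems in \<open>auto simp: handle_frame\<close>)
  qed
  then show ?thesis using that by blast
qed

text \<open>The argument of \<open>write_phase\<close>, with the acknowledgements of call
  \<open>c\<close>. The second disjunct allows for a later readTag already in progress.\<close>

lemma read_phase:
  assumes call: "transition n f (\<rho> a) (\<rho> (Suc a)) q outs" "(ReadTag c, {1..n}) \<in> set outs"
    and T: "now (\<rho> a) + 2 * D \<le> T" and q: "q \<notin> crashed (\<rho> (at_time T))"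
  shows "pc (state (at_time T) q) \<noteq> WaitRead \<or> read_no (state (at_time T) q) \<noteq> c"
proof (rule ccontr)
  let ?s = "state (at_time T) q"
  assume "\<not> ?thesis"
  then have reading: "pc ?s = WaitRead" "read_no ?s = c" by auto
  have T0: "0 \<le> T" using T D_pos now_nonneg[of a] by simp
  have node: "q \<in> {1..n}" using call(1) by (simp add: transition_def)
  have "j \<in> read_ackers ?s" if j: "j \<in> {1..n} - faulty \<rho>" for j
  proof -
    have j': "j \<in> {1..n}" "j \<notin> faulty \<rho>" using j by auto
    have resp: "\<exists>J. (ReadAck c (max_tag s), J) \<in> set (handler_sends n j q (ReadTag c) s) \<and> q \<in> J"
      for s :: "'v node_state" by auto
    obtain k t where k: "k < at_time T" "state (Suc k) q = handle q j (ReadAck c t) (state k q)"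
      using round_trip[OF call j' resp T q] by metis
    then have "(j, c, t) \<in> read_acks (state (Suc k) q)" by simp
    then show ?thesis
      using read_acks_mono[of "Suc k" "at_time T" q] k(1) reading(2) by (auto simp: read_ackers_def)
  qed
  moreover have "finite (read_ackers ?s)"
    by (rule finite_subset[of _ "{1..n}"]) (auto simp: read_ackers_def dest: read_acks_wf(2))
  ultimately have card: "n - f \<le> card (read_ackers ?s)"
    using card_nonfaulty card_mono by (meson le_trans subsetI)
  have "pending ?s \<noteq> None" using reading(1) by (intro pending_operation) simp
  then obtain opn where opn: "pending ?s = Some opn" by blast
  note quiet = at_time_quiescent(1)[OF T0 node q]
  show False
  proof (cases opn)
    case Scan
    show ?thesis using local_step.read_done_scan[OF reading(1) _ card] opn Scan quiet by blast
  next
    case (Update v)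
    show ?thesis using local_step.read_done_update[OF reading(1) _ card] opn Update quiet by blast
  qed
qed

text \<open>A readTag begun before \<open>m\<close> is over by \<open>at_time (T + 2 * D)\<close>.
  So this one began at \<open>m\<close> or later, and some node of the quorum that knew
  \<open>r\<close> at \<open>m\<close> answered it with a tag of at least \<open>r\<close>.\<close>

lemma read_result_ge:
  assumes quorum: "n - f \<le> card {j \<in> {1..n}. r \<le> max_tag (state m j)}"
    and m: "now (\<rho> m) \<le> T" and k: "at_time (T + 2 * D) \<le> k"
    and read: "pc (state k q) = WaitRead" "q \<notin> crashed (\<rho> k)"
    and card: "n - f \<le> card (read_ackers (state k q))"
  shows "r \<le> read_result (state k q)"
proof -
  let ?T = "T + 2 * D"
  obtain a outs where a: "a < k" "transition n f (\<rho> a) (\<rho> (Suc a)) q outs"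
    "(ReadTag (read_no (state k q)), {1..n}) \<in> set outs"
    "read_no (state a q) < read_no (state k q)"
    "\<And>b. a < b \<Longrightarrow> b \<le> k \<Longrightarrow> pc (state b q) = WaitRead \<and> read_no (state b q) = read_no (state k q)"
    using read_start[OF read(1)] by metis
  have m': "m \<le> at_time ?T" using m D_pos by (intro le_at_time) simp
  have "m \<le> a"
  proof (rule ccontr)
    assume "\<not> m \<le> a"
    then have "now (\<rho> a) + 2 * D \<le> ?T" using now_mono[of a m] m by simp
    from read_phase[OF a(2,3) this] show False
      using a(5)[OF _ k] \<open>\<not> m \<le> a\<close> m' crashed_mono[OF k] read(2) by auto
  qed
  then have fresh: "read_no (state m q) < read_no (state k q)"
    using read_no_mono[of m a q] a(4) by simp
  let ?A = "{j \<in> {1..n}. r \<le> max_tag (state m j)}" and ?B = "read_ackers (state k q)"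
  have B: "?B \<subseteq> {1..n}" by (auto simp: read_ackers_def dest: read_acks_wf(2))
  \<comment> \<open>Two sets of at least \<open>n - f\<close> nodes each meet because
    \<open>2 * f < n\<close>.\<close>
  have "?A \<inter> ?B \<noteq> {}"
  proof
    assume "?A \<inter> ?B = {}"
    then have "card ?A + card ?B = card (?A \<union> ?B)"
      using B by (intro card_Un_disjoint[symmetric]) (auto intro: finite_subset)
    also have "\<dots> \<le> card {1..n}" using B by (intro card_mono) auto
    finally show False using quorum card majority by simp
  qed
  then obtain j t where j: "r \<le> max_tag (state m j)" "(j, read_no (state k q), t) \<in> read_acks (state k q)"
    by (auto simp: read_ackers_def)
  have "m \<le> k" using m' k by simp
  have "(j, read_no (state k q), t) \<notin> read_acks (state m q)"
    using read_acks_wf(2)[where k = m] fresh by fastforce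
  moreover have "(ReadAck (read_no (state k q)) t, u) \<notin> set (chan (\<rho> m) j q)" for u
    using read_acks_wf(1)[where k = m] fresh by fastforce
  ultimately have "r \<le> t"
    by (intro fresh_read_ack[OF j(1) fresh j(2) _ _ \<open>m \<le> k\<close>])
  moreover have "t \<le> read_result (state k q)"
    unfolding read_result_def
  proof (rule Max_ge)
    have "{t. \<exists>j. (j, read_no (state k q), t) \<in> read_acks (state k q)}
        \<subseteq> (\<lambda>(j, c, t). t) ` read_acks (state k q)" by force
    then show "finite {t. \<exists>j. (j, read_no (state k q), t) \<in> read_acks (state k q)}"
      using finite_read_acks finite_subset by blast
  qed (use j in auto)
  ultimately show ?thesis by simp
qed

section \<open>How values travel while EQ is false\<close>

lemma vals_step:
  assumes "x \<in> vals (state (Suc k) q) l" "x \<notin> vals (state k q) l"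
  obtains j u where "transition n f (\<rho> k) (\<rho> (Suc k)) q (handler_sends n q j (Value x) (state k q))"
    "(Value x, u) \<in> set (chan (\<rho> k) j q)" "state (Suc k) q = handle q j (Value x) (state k q)"
  using run_step[of k]
proof (cases rule: step_state_cases[where q = q])
  case (local outs)
  then show ?thesis using assms local_step_frame(1) by metis
next
  case (receive j m u)
  then have "m = Value x" using assms by (cases m) (auto split: if_splits)
  then show ?thesis using that receive by blast
qed (use assms in auto)

text \<open>The handler enters a value for its sender and for the node itself at once. Hence a
  failure of EQ is one-sided: some other entry lacks an element of the own one.\<close>

lemma vals_self: "vals (state k q) l \<subseteq> vals (state k q) q"
proof (induction k)
  case 0
  show ?case by (simp add: run_start init_config_def init_node_def)
next
  case (Suc k)
  show ?case
  proof
    fix x assume x: "x \<in> vals (state (Suc k) q) l"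
    show "x \<in> vals (state (Suc k) q) q"
    proof (cases "x \<in> vals (state k q) l")
      case True
      then show ?thesis using Suc vals_mono[of k "Suc k" q q] by auto
    next
      case False
      then show ?thesis using x by (elim vals_step) auto
    qed
  qed
qed

lemma value_received:
  assumes sent: "(Value x, u) \<in> set (chan (\<rho> a) p q)" and q: "q \<notin> crashed (\<rho> (at_time T))"
    and T: "u + D \<le> T" "0 \<le> T" "a \<le> at_time T"
  shows "x \<in> vals (state (at_time T) q) p" "x \<in> vals (state (at_time T) q) q"
proof -
  obtain k where k: "k < at_time T" "state (Suc k) q = handle q p (Value x) (state k q)"
    using delivery[OF sent q T] by metis
  then have "x \<in> vals (state (Suc k) q) p" "x \<in> vals (state (Suc k) q) q" by simp_all
  then show "x \<in> vals (state (at_time T) q) p" "x \<in> vals (state (at_time T) q) q"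
    using vals_mono[of "Suc k" "at_time T"] k(1) by (meson Suc_leI subsetD)+
qed

text \<open>Node \<open>i\<close> forwarded \<open>x\<close> to all in the action in which it first
  received it, and it survived that action, so the broadcast was completed.\<close>

lemma value_spread:
  assumes x: "x \<in> vals (state m i) i" and T: "now (\<rho> m) + D \<le> T"
    and i: "i \<notin> crashed (\<rho> (at_time T))" and j: "j \<in> {1..n}" "j \<notin> crashed (\<rho> (at_time T))"
  shows "x \<in> vals (state (at_time T) j) i" "x \<in> vals (state (at_time T) j) j"
proof -
  have m: "m \<le> at_time T" using T D_pos by (intro le_at_time) simp
  have T0: "0 \<le> T" using T D_pos now_nonneg[of m] by simp
  have "x \<notin> vals (state 0 i) i" by (simp add: run_start init_config_def init_node_def)
  then obtain k where k: "k < m" "x \<notin> vals (state k i) i" "x \<in> vals (state (Suc k) i) i"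
    using first_change[of "\<lambda>k. x \<in> vals (state k i) i" 0 m] x by blast
  obtain l where l: "transition n f (\<rho> k) (\<rho> (Suc k)) i (handler_sends n i l (Value x) (state k i))"
    using vals_step[OF k(3,2)] by metis
  have Suck: "Suc k \<le> at_time T" using k(1) m by simp
  then have "i \<notin> crashed (\<rho> (Suc k))" using i crashed_mono by blast
  then have "(Value x, now (\<rho> k)) \<in> set (chan (\<rho> (Suc k)) i j)"
    using sent[OF l, of "Value x" "{1..n}" j] k(2) j(1) by simp
  moreover have "now (\<rho> k) + D \<le> T" using now_mono[of k m] k(1) T by simp
  ultimately show "x \<in> vals (state (at_time T) j) i" "x \<in> vals (state (at_time T) j) j"
    using value_received[OF _ j(2) _ T0 Suck] by blast+
qed

text \<open>Had \<open>i\<close> known \<open>x\<close> at time \<open>T - 2 * D\<close>, a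
  nonfaulty \<open>j\<close> would have received it by \<open>T - D\<close> and its copy would be
  back at \<open>i\<close> by \<open>T\<close>.\<close>

lemma waiting_new_value:
  assumes pc: "pc (state (at_time T) i) = WaitEQ p r" and T: "2 * D \<le> T"
    and i: "i \<in> {1..n}" "i \<notin> crashed (\<rho> (at_time T))"
  obtains x where "tag_of x \<le> r" "x \<in> vals (state (at_time T) i) i"
    "x \<notin> vals (state (at_time (T - 2 * D)) i) i"
proof -
  let ?s = "state (at_time T) i"
  have T': "0 \<le> T" "0 \<le> T - D" "0 \<le> T - 2 * D" using T D_pos by auto
  \<comment> \<open>Whatever \<open>max_tag\<close> is, one of the two exits of Lattice would be
    enabled.\<close>
  have "\<not> eq_holds n f i r ?s"
    using at_time_quiescent(1)[OF T'(1) i] local_step.lattice_true[OF pc] local_step.lattice_false[OF pc]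
    by blast
  \<comment> \<open>Otherwise the nonfaulty nodes would serve as the set \<open>Q\<close> of
    EQ.\<close>
  then obtain j where j: "j \<in> {1..n} - faulty \<rho>" "upto_tag r (vals ?s j) \<noteq> upto_tag r (vals ?s i)"
    using card_nonfaulty unfolding eq_holds_def EQ_def by (metis Diff_subset)
  then obtain x where x: "x \<in> vals ?s i" "x \<notin> vals ?s j" "tag_of x \<le> r"
    using vals_self[of "at_time T" i j] by (auto simp: upto_tag_def)
  have j': "j \<in> {1..n}" "j \<notin> crashed (\<rho> m)" for m using j(1) not_faulty by auto
  have i': "i \<notin> crashed (\<rho> (at_time (T - D)))"
    using crashed_mono[of "at_time (T - D)" "at_time T"] at_time_mono[OF T'(2)] D_pos i(2) by auto
  have "x \<notin> vals (state (at_time (T - 2 * D)) i) i"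
  proof
    assume "x \<in> vals (state (at_time (T - 2 * D)) i) i"
    then have "x \<in> vals (state (at_time (T - D)) j) j"
      using value_spread(2)[OF _ _ i' j'] now_at_time[OF T'(3)] by simp
    then have "x \<in> vals ?s j"
      using value_spread(1)[OF _ _ j'(2) i] now_at_time[OF T'(2)] by simp
    then show False using x(2) by simp
  qed
  then show ?thesis using that x by blast
qed

section \<open>Spreading values and the crashes they cost\<close>

text \<open>
  Once no value \<open>x\<close> is originated any more, \<open>x\<close> reaches no further live node when it is not spreading.
\<close>

definition spreading :: "'v tsval \<Rightarrow> nat \<Rightarrow> bool" where
  "spreading x m \<longleftrightarrow>
     (\<exists>p q u. q \<notin> crashed (\<rho> m) \<and> (Value x, u) \<in> set (chan (\<rho> m) p q) \<and> x \<notin> vals (state m q) q)"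

text \<open>By \<open>old\<close>, a value originated now has a tag larger than that of
  \<open>x\<close>, so a new message with \<open>x\<close> is a forward. Its sender is live and
  receives \<open>x\<close> for the first time, which is itself an instance of spreading before the
  step.\<close>

lemma spreading_step:
  assumes "spreading x (Suc m)"
    and old: "\<And>p. pc (state m p) = WaitRead \<Longrightarrow> p \<notin> crashed (\<rho> m) \<Longrightarrow>
      n - f \<le> card (read_ackers (state m p)) \<Longrightarrow> tag_of x \<le> read_result (state m p)"
  shows "spreading x m"
proof -
  obtain p q u where q: "q \<notin> crashed (\<rho> (Suc m))" "(Value x, u) \<in> set (chan (\<rho> (Suc m)) p q)"
    "x \<notin> vals (state (Suc m) q) q"
    using assms(1) by (auto simp: spreading_def)
  have q': "q \<notin> crashed (\<rho> m)" "x \<notin> vals (state m q) q"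
    using q crashed_mono[of m "Suc m"] vals_mono[of m "Suc m" q q] by auto
  show ?thesis
  proof (cases "(Value x, u) \<in> set (chan (\<rho> m) p q)")
    case True
    then show ?thesis using q' by (auto simp: spreading_def)
  next
    case False
    from run_step[of m] show ?thesis
    proof (cases rule: step_cases)
      case quiet
      then show ?thesis using False q(2) by simp
    next
      case (transition i outs)
      then obtain J where J: "p = i" "(Value x, J) \<in> set outs" "i \<notin> crashed (\<rho> m)"
        using False q(2) unfolding transition_def by blast
      from transition J(2) show ?thesis
      proof (cases rule: transition_sends_value)
        case (originate v)
        then show ?thesis using old[of i] J(3) by simp
      next
        case (forward l v)
        then show ?thesis using J(3) by (auto simp: spreading_def)
      qed
    qed
  qed
qed

text \<open>Just before \<open>i\<close> first receives \<open>x\<close>, the message on its way to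
  \<open>i\<close> makes \<open>x\<close> spreading; \<open>spreading_step\<close> carries this back
  to \<open>m\<close>.\<close>

lemma spreading_until_received:
  assumes x: "x \<notin> vals (state m i) i" "x \<in> vals (state k i) i" and i: "i \<notin> crashed (\<rho> k)"
    and old: "\<And>l p. m \<le> l \<Longrightarrow> pc (state l p) = WaitRead \<Longrightarrow> p \<notin> crashed (\<rho> l) \<Longrightarrow>
      n - f \<le> card (read_ackers (state l p)) \<Longrightarrow> tag_of x \<le> read_result (state l p)"
    and "m \<le> k"
  shows "spreading x m"
proof -
  obtain l where l: "m \<le> l" "l < k" "x \<notin> vals (state l i) i" "x \<in> vals (state (Suc l) i) i"
    using first_change[of "\<lambda>k. x \<in> vals (state k i) i", OF x \<open>m \<le> k\<close>] by blast
  have "i \<notin> crashed (\<rho> l)" using i crashed_mono[of l k] l(2) by auto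
  then have "spreading x l"
    using vals_step[OF l(4,3)] l(3) unfolding spreading_def by metis
  moreover have "spreading x l \<Longrightarrow> spreading x m"
    using \<open>m \<le> l\<close>
  proof (induction l rule: dec_induct)
    case (step l)
    then show ?case using spreading_step old by blast
  qed
  ultimately show ?thesis by blast
qed

text \<open>
  The new message in the channel shows that the broadcast interrupted by the crash is the one of \<open>x\<close>.
\<close>

definition loses :: "'v tsval \<Rightarrow> nat \<Rightarrow> node \<Rightarrow> bool" where
  "loses x k p \<longleftrightarrow> p \<notin> crashed (\<rho> k) \<and> p \<in> crashed (\<rho> (Suc k)) \<and>
     (\<exists>q u. (Value x, u) \<in> set (chan (\<rho> (Suc k)) p q) - set (chan (\<rho> k) p q))"

lemma new_value_transition:
  assumes "(Value x, u) \<in> set (chan (\<rho> (Suc k)) p q) - set (chan (\<rho> k) p q)"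
  shows "transition n f (\<rho> k) (\<rho> (Suc k)) p [(Value x, {1..n})]" "u = now (\<rho> k)"
proof -
  have "transition n f (\<rho> k) (\<rho> (Suc k)) p [(Value x, {1..n})] \<and> u = now (\<rho> k)"
    using run_step[of k]
  proof (cases rule: step_cases)
    case (transition i outs)
    then obtain J where J: "p = i" "(Value x, J) \<in> set outs" "u = now (\<rho> k)"
      using assms unfolding transition_def by blast
    from transition J(2) have "outs = [(Value x, {1..n})]"
      by (cases rule: transition_sends_value)
    then show ?thesis using transition J by simp
  qed (use assms in auto)
  then show "transition n f (\<rho> k) (\<rho> (Suc k)) p [(Value x, {1..n})]" "u = now (\<rho> k)" by auto
qed

lemma new_value_unique:
  assumes "(Value x, u) \<in> set (chan (\<rho> (Suc k)) p q) - set (chan (\<rho> k) p q)"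
    and "(Value y, v) \<in> set (chan (\<rho> (Suc k)) p l) - set (chan (\<rho> k) p l)"
  shows "x = y"
proof -
  have "\<exists>J. (Value y, J) \<in> set [(Value x, {1..n})]"
    using assms(2) new_value_transition(1)[OF assms(1)] unfolding transition_def by blast
  then show ?thesis by simp
qed

definition losers :: "'v tsval \<Rightarrow> node set" where
  "losers x = {p. \<exists>k. loses x k p}"

lemma losers_faulty: "losers x \<subseteq> faulty \<rho>"
  by (auto simp: losers_def loses_def faulty_def)

text \<open>A node crashes in a single step, and the action of that step broadcasts only one
  value.\<close>

lemma losers_disjoint:
  assumes "x \<noteq> y"
  shows "losers x \<inter> losers y = {}"
proof (rule ccontr)
  assume "losers x \<inter> losers y \<noteq> {}"
  then obtain p k l where k: "loses x k p" and l: "loses y l p" by (auto simp: losers_def)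
  have "\<not> Suc k \<le> l" "\<not> Suc l \<le> k"
    using k l crashed_mono[of "Suc k" l] crashed_mono[of "Suc l" k] by (auto simp: loses_def)
  then have "k = l" by simp
  then show False using k l assms new_value_unique unfolding loses_def by blast
qed

text \<open>
  A message spreading \<open>x\<close> at time \<open>T\<close> was sent within the preceding message delay; had its
  broadcast been completed, \<open>x\<close> would reach \<open>i\<close> by time \<open>T + D\<close>.
\<close>

lemma spreading_loses:
  assumes "spreading x (at_time T)" and T: "D \<le> T"
    and i: "i \<in> {1..n}" "i \<notin> crashed (\<rho> (at_time (T + D)))"
    and x: "x \<notin> vals (state (at_time (T + D)) i) i"
  obtains k p where "at_time (T - D) \<le> k" "k < at_time T" "loses x k p"
proof -
  have T': "0 \<le> T - D" "0 \<le> T" "T - D \<le> T" "0 \<le> T + D" "T \<le> T + D" using T D_pos by auto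
  obtain p q u where q: "q \<notin> crashed (\<rho> (at_time T))" "(Value x, u) \<in> set (chan (\<rho> (at_time T)) p q)"
    using assms(1) by (auto simp: spreading_def)
  have "T < u + D" using at_time_quiescent(2)[OF T'(2) _ q] chan_wf(2)[OF q(2)] by blast
  then have "(Value x, u) \<notin> set (chan (\<rho> (at_time (T - D))) p q)"
    using chan_wf(3)[of "Value x" u "at_time (T - D)" p q] now_at_time[OF T'(1)] by auto
  then obtain k where k: "at_time (T - D) \<le> k" "k < at_time T"
    "(Value x, u) \<in> set (chan (\<rho> (Suc k)) p q) - set (chan (\<rho> k) p q)"
    using first_change[of "\<lambda>k. (Value x, u) \<in> set (chan (\<rho> k) p q)", OF _ q(2) at_time_mono[OF T'(1,3)]]
    by blast
  note new = new_value_transition[OF k(3)]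
  have "p \<in> crashed (\<rho> (Suc k))"
  proof (rule ccontr)
    assume "p \<notin> crashed (\<rho> (Suc k))"
    then have *: "(Value x, now (\<rho> k)) \<in> set (chan (\<rho> (Suc k)) p i)"
      using sent[OF new(1)] i(1) by simp
    have "Suc k \<le> at_time (T + D)" using k(2) at_time_mono[OF T'(2,5)] by simp
    moreover have "now (\<rho> k) + D \<le> T + D"
      using now_mono[of k "at_time T"] k(2) now_at_time[OF T'(2)] by simp
    ultimately show False using value_received(2)[OF * i(2) _ T'(4)] x by blast
  qed
  then have "loses x k p" using new(1) k(3) by (auto simp: loses_def transition_def)
  then show ?thesis using that k by blast
qed

text \<open>Each of the \<open>S\<close> consecutive message delays contains a crash charged to
  \<open>x\<close>, and a node crashes only once. The bound \<open>S + 1\<close> appears because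
  \<open>spreading_loses\<close> looks one delay past its window.\<close>

lemma card_losers:
  assumes T: "0 \<le> T" and spread: "\<And>s. 1 \<le> s \<Longrightarrow> s \<le> S \<Longrightarrow> spreading x (at_time (T + real s * D))"
    and i: "i \<in> {1..n}" "i \<notin> crashed (\<rho> (at_time (T + (real S + 1) * D)))"
    and x: "x \<notin> vals (state (at_time (T + (real S + 1) * D)) i) i"
  shows "S \<le> card (losers x)"
proof -
  let ?t = "\<lambda>s. at_time (T + real s * D)"
  have t_mono: "?t s \<le> ?t s'" if "s \<le> s'" for s s'
    using that T D_pos by (intro at_time_mono) auto
  have "\<exists>k p. ?t (s - 1) \<le> k \<and> k < ?t s \<and> loses x k p" if s: "s \<in> {1..S}" for s
  proof -
    have eq: "T + real s * D + D = T + real (Suc s) * D" "T + real s * D - D = T + real (s - 1) * D"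
      "T + (real S + 1) * D = T + real (Suc S) * D"
      using s by (auto simp: algebra_simps of_nat_diff)
    have le: "?t (Suc s) \<le> ?t (Suc S)" using s by (intro t_mono) simp
    have "i \<notin> crashed (\<rho> (?t (Suc s)))" "x \<notin> vals (state (?t (Suc s)) i) i"
      using i(2) x crashed_mono[OF le] vals_mono[OF le] unfolding eq by blast+
    moreover have "1 * D \<le> real s * D" using s D_pos by (intro mult_right_mono) auto
    then have "D \<le> T + real s * D" using T by simp
    moreover have "spreading x (?t s)" using spread[of s] s by simp
    ultimately show ?thesis
      using spreading_loses[of x "T + real s * D" i] i(1) unfolding eq by metis
  qed
  then obtain k p where kp: "\<And>s. s \<in> {1..S} \<Longrightarrow> ?t (s - 1) \<le> k s \<and> k s < ?t s \<and> loses x (k s) (p s)"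
    by metis
  have distinct: "p s \<noteq> p s'" if "s \<in> {1..S}" "s' \<in> {1..S}" "s < s'" for s s'
  proof -
    have "k s < ?t s" "?t (s' - 1) \<le> k s'" using kp that by blast+
    moreover have "?t s \<le> ?t (s' - 1)" using that(3) by (intro t_mono) simp
    ultimately have "Suc (k s) \<le> k s'" by (meson Suc_leI less_le_trans)
    then have "crashed (\<rho> (Suc (k s))) \<subseteq> crashed (\<rho> (k s'))" by (rule crashed_mono)
    then show ?thesis using kp[OF that(1)] kp[OF that(2)] unfolding loses_def by force
  qed
  then have "inj_on p {1..S}" by (metis inj_onI linorder_neqE_nat)
  moreover have "p ` {1..S} \<subseteq> losers x" using kp unfolding losers_def by blast
  ultimately show ?thesis
    using card_inj_on_le[of p "{1..S}" "losers x"] finite_subset[OF losers_faulty finite_faulty] by simp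
qed

section \<open>The bound for one lattice operation\<close>

lemma lattice_starts_transition:
  assumes "lattice_starts \<rho> i r a"
  obtains p outs where "transition n f (\<rho> a) (\<rho> (Suc a)) i outs" "(WriteTag r, {1..n}) \<in> set outs"
    "pc (state (Suc a) i) = WaitWrite p r"
proof -
  obtain p where p: "pc (state a i) = CallLattice p r" "pc (state (Suc a) i) = WaitWrite p r"
    using assms by (auto simp: lattice_starts_def)
  from run_step[of a] show ?thesis
  proof (cases rule: step_state_cases[where q = i])
    case (local outs)
    then show ?thesis using that local_step_frame(12)[OF local(2) p(2)] p(2) by blast
  qed (use p in \<open>auto simp: handle_frame\<close>)
qed

lemma waiting_step:
  assumes "pc (state k i) = WaitWrite p r \<or> pc (state k i) = WaitEQ p r"
  shows "pc (state (Suc k) i) = WaitWrite p r \<and> pc (state k i) = WaitWrite p r \<or>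
    pc (state (Suc k) i) = WaitEQ p r \<or> lattice_returns \<rho> i r k"
  using run_step[of k]
proof (cases rule: step_state_cases[where q = i])
  case (local outs)
  then show ?thesis
    using assms local_step_frame(8,9)[OF local(2)] unfolding lattice_returns_def by blast
qed (use assms in \<open>auto simp: handle_frame\<close>)

text \<open>The first return after \<open>a\<close> would complete the call. Earlier returns are
  excluded for every tag, since \<open>lattice_completes\<close> demands this.\<close>

lemma lattice_waits:
  assumes start: "lattice_starts \<rho> i r a" and pc: "pc (state (Suc a) i) = WaitWrite p r"
    and incomplete: "\<And>k. k \<le> b \<Longrightarrow> \<not> lattice_completes \<rho> i r a k"
    and "a < k" "k \<le> b"
  shows "(pc (state k i) = WaitWrite p r \<or> pc (state k i) = WaitEQ p r) \<and>
    (\<forall>m r'. a < m \<and> m < k \<longrightarrow> \<not> lattice_returns \<rho> i r' m)"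
  using Suc_leI[OF \<open>a < k\<close>] \<open>k \<le> b\<close>
proof (induction k rule: dec_induct)
  case base
  then show ?case using pc by auto
next
  case (step k)
  then have "\<not> lattice_returns \<rho> i r k"
    using incomplete[of k] start by (auto simp: lattice_completes_def)
  then have pc': "pc (state (Suc k) i) = WaitWrite p r \<or> pc (state (Suc k) i) = WaitEQ p r"
    using waiting_step[of k i p r] step by auto
  then have "\<not> lattice_returns \<rho> i r' k" for r' by (auto simp: lattice_returns_def)
  then show ?case using step pc' by (auto simp: less_Suc_eq)
qed

lemma waiting_persists:
  assumes "pc (state k i) = WaitEQ p r" "k \<le> m"
    and "\<And>l. k \<le> l \<Longrightarrow> l < m \<Longrightarrow> \<not> lattice_returns \<rho> i r l"
  shows "pc (state m i) = WaitEQ p r"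
  using assms(2,3)
proof (induction m rule: dec_induct)
  case (step m)
  then show ?case using waiting_step[of m i p r] by auto
qed (rule assms(1))

lemma lattice_delay:
  assumes start: "lattice_starts \<rho> i r a"
  shows "takes_at_most D \<rho> i r a (2 * sqrt (real (card (faulty \<rho>))) + 8)"
proof (rule ccontr)
  assume late: "\<not> ?thesis"
  let ?k = "card (faulty \<rho>)"
  \<comment> \<open>The least natural number whose square exceeds the number of crashes.\<close>
  define M where "M = nat \<lfloor>sqrt (real ?k)\<rfloor> + 1"
  have M: "sqrt (real ?k) < real M" "real M \<le> sqrt (real ?k) + 1"
  proof -
    have "real M = of_int \<lfloor>sqrt (real ?k)\<rfloor> + 1" by (simp add: M_def)
    then show "sqrt (real ?k) < real M" "real M \<le> sqrt (real ?k) + 1" by linarith+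
  qed
  \<comment> \<open>The offset 4 covers two delays for the write phase and two for the reads that
    began before its end. From \<open>t 0\<close> on, no live node originates a value with tag at
    most \<open>r\<close>.\<close>
  define t where "t s = now (\<rho> a) + (real s + 4) * D" for s
  have t_nonneg: "0 \<le> t s" for s using now_nonneg[of a] D_pos by (simp add: t_def)
  have t_le: "t s \<le> t s'" if "s \<le> s'" for s s' using that D_pos by (simp add: t_def)
  have t_mono: "at_time (t s) \<le> at_time (t s')" if "s \<le> s'" for s s'
    using that t_le t_nonneg by (intro at_time_mono)
  define X where "X = at_time (t (2 * M + 2))"
  \<comment> \<open>This fixes the constant: \<open>2 * M + 2 + 4\<close> is at most
    \<open>2 * sqrt k + 8\<close>, as \<open>M\<close> is at most \<open>sqrt k + 1\<close>.\<close>
  have "t (2 * M + 2) \<le> now (\<rho> a) + (2 * sqrt (real ?k) + 8) * D"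
    unfolding t_def using M(2) D_pos by (intro add_left_mono mult_right_mono) simp_all
  then have "now (\<rho> m) \<le> now (\<rho> a) + (2 * sqrt (real ?k) + 8) * D" if "m \<le> X" for m
    using now_mono[of m X] now_at_time[OF t_nonneg[of "2 * M + 2"]] that unfolding X_def by simp
  then have incomplete: "\<not> lattice_completes \<rho> i r a m" and live: "i \<notin> crashed (\<rho> m)" if "m \<le> X" for m
    using late that unfolding takes_at_most_def by blast+
  obtain p outs where call: "transition n f (\<rho> a) (\<rho> (Suc a)) i outs" "(WriteTag r, {1..n}) \<in> set outs"
    and pc: "pc (state (Suc a) i) = WaitWrite p r"
    using lattice_starts_transition[OF start] by metis
  have node: "i \<in> {1..n}" using call(1) by (simp add: transition_def)
  note waits = lattice_waits[OF start pc incomplete]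
  define T0 where "T0 = now (\<rho> a) + 2 * D"
  have T0: "0 \<le> T0" "T0 \<le> t 0" "T0 + 2 * D = t 0"
    using now_nonneg[of a] D_pos by (auto simp: T0_def t_def)
  have tX: "at_time (t s) \<le> X" if "s \<le> 2 * M + 2" for s
    unfolding X_def by (intro t_mono that)
  have T0X: "at_time T0 \<le> at_time (t 0)" using T0 by (intro at_time_mono)
  then have T0X': "at_time T0 \<le> X" using tX[of 0] by simp
  \<comment> \<open>Having left \<open>WaitWrite\<close> without completing, the call can only be in
    \<open>WaitEQ\<close>.\<close>
  obtain e where e: "a < e" "e \<le> at_time T0" "pc (state e i) = WaitEQ p r"
    using write_phase[OF call, of T0 p] live[OF T0X'] waits T0X' unfolding T0_def
    by (metis order.refl order.trans)
  have waiting: "pc (state m i) = WaitEQ p r" if "e \<le> m" "m \<le> X" for m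
  proof (rule waiting_persists[OF e(3) that(1)])
    fix l assume "e \<le> l" "l < m"
    then have "a < l" "a < m" using e(1) by auto
    then show "\<not> lattice_returns \<rho> i r l"
      using waits[of X m] that(2) \<open>l < m\<close> by blast
  qed
  have now_e: "now (\<rho> e) \<le> T0" using now_mono[OF e(2)] now_at_time[OF T0(1)] by simp
  have old: "tag_of x \<le> read_result (state l q)"
    if "tag_of x \<le> r" "at_time (t 0) \<le> l" "pc (state l q) = WaitRead" "q \<notin> crashed (\<rho> l)"
      "n - f \<le> card (read_ackers (state l q))" for x :: "'v tsval" and l q
    using read_result_ge[OF waiting_quorum[OF e(3)] now_e _ that(3-5)] that(1,2) T0(3) by simp
  \<comment> \<open>There are \<open>M\<close> windows of two delays, from
    \<open>t (2 * v + 2)\<close> to \<open>t (2 * v + 4)\<close>; the last one ends at the horizon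
    \<open>X\<close>. Starting at \<open>t 2\<close> makes even the first value cost one
    crash.\<close>
  have "\<exists>x. tag_of x \<le> r \<and> x \<in> vals (state (at_time (t (2 * v + 4))) i) i \<and>
      x \<notin> vals (state (at_time (t (2 * v + 2))) i) i" if v: "v < M" for v
  proof -
    have X: "at_time (t (2 * v + 4)) \<le> X" using v by (intro tX) simp
    have "e \<le> at_time (t (2 * v + 4))" using e(2) T0X t_mono[of 0 "2 * v + 4"] by simp
    from waiting[OF this X] have "pc (state (at_time (t (2 * v + 4))) i) = WaitEQ p r" .
    moreover have "t (2 * v + 4) - 2 * D = t (2 * v + 2)" by (simp add: t_def algebra_simps)
    moreover have "2 * D \<le> t (2 * v + 4)" using t_nonneg[of "2 * v + 2"] calculation(2) by simp
    ultimately show ?thesis using waiting_new_value[of "t (2 * v + 4)" i p r] node live[OF X] by metis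
  qed
  then obtain x where x: "\<And>v. v < M \<Longrightarrow> tag_of (x v) \<le> r \<and>
      x v \<in> vals (state (at_time (t (2 * v + 4))) i) i \<and>
      x v \<notin> vals (state (at_time (t (2 * v + 2))) i) i"
    by metis
  \<comment> \<open>The value \<open>x v\<close> is created before \<open>t 0\<close> or never, yet
    is missing at \<open>i\<close> until \<open>t (2 * v + 2)\<close>; this leaves
    \<open>2 * v + 1\<close> delays to charge.\<close>
  have lose: "2 * v + 1 \<le> card (losers (x v))" if v: "v < M" for v
  proof (rule card_losers[OF t_nonneg[of 0] _ node])
    have eq: "t 0 + (real (2 * v + 1) + 1) * D = t (2 * v + 2)" "\<And>s. t 0 + real s * D = t s"
      by (auto simp: t_def algebra_simps)
    show "i \<notin> crashed (\<rho> (at_time (t 0 + (real (2 * v + 1) + 1) * D)))"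
      unfolding eq using v by (intro live tX) simp
    show "x v \<notin> vals (state (at_time (t 0 + (real (2 * v + 1) + 1) * D)) i) i"
      unfolding eq using x[OF v] by simp
    show "spreading (x v) (at_time (t 0 + real s * D))" if "s \<le> 2 * v + 1" for s
    proof -
      have le: "at_time (t s) \<le> at_time (t (2 * v + 2))" using that by (intro t_mono) simp
      have le': "at_time (t s) \<le> at_time (t (2 * v + 4))" using that by (intro t_mono) simp
      have "x v \<notin> vals (state (at_time (t s)) i) i" using x[OF v] vals_mono[OF le] by blast
      moreover have "at_time (t (2 * v + 4)) \<le> X" using v by (intro tX) simp
      ultimately show ?thesis
        unfolding eq
        using spreading_until_received[of "x v" "at_time (t s)" i "at_time (t (2 * v + 4))"]
          x[OF v] live le' old[of "x v"] t_mono[of 0 s] by (meson le0 order.trans)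
    qed
  qed
  \<comment> \<open>The value \<open>x v\<close> has arrived by \<open>t (2 * v + 4)\<close>, no
    later than \<open>t (2 * w + 2)\<close>, when \<open>x w\<close> is still missing.\<close>
  have "x v \<noteq> x w" if "v < w" "w < M" for v w
    using x[of v] x[of w] that vals_mono[OF t_mono[of "2 * v + 4" "2 * w + 2"], of i i] by force
  then have disj: "losers (x v) \<inter> losers (x w) = {}" if "v \<noteq> w" "v < M" "w < M" for v w
    using losers_disjoint that by (metis linorder_neqE_nat)
  \<comment> \<open>The lower bounds are the first \<open>M\<close> odd numbers.\<close>
  have "M\<^sup>2 = (\<Sum>v<M. 2 * v + 1)" by (induction M) (auto simp: power2_eq_square)
  also have "\<dots> \<le> (\<Sum>v<M. card (losers (x v)))" by (intro sum_mono lose) simp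
  also have "\<dots> = card (\<Union>v<M. losers (x v))"
    using disj finite_subset[OF losers_faulty finite_faulty]
    by (intro card_UN_disjoint[symmetric]) auto
  also have "\<dots> \<le> ?k" using losers_faulty by (intro card_mono[OF finite_faulty] UN_least)
  finally have "(real M)\<^sup>2 \<le> real ?k" by (metis of_nat_le_iff of_nat_power)
  then have "real M \<le> sqrt (real ?k)" by (rule real_le_rsqrt)
  then show False using M(1) by simp
qed

end

theorem lemma31:
  shows "\<exists>c :: nat \<Rightarrow> real. c \<in> O(\<lambda>k. sqrt (real k)) \<and>
    (\<forall>(n :: nat) (f :: nat) (D :: real) (\<rho> :: nat \<Rightarrow> 'v config).
       2 * f < n \<longrightarrow> 0 < D \<longrightarrow> execution n f D \<rho> \<longrightarrow>
       (\<forall>i r a. lattice_starts \<rho> i r a \<longrightarrow>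
          takes_at_most D \<rho> i r a (c (card (faulty \<rho>)))))"
proof (intro exI conjI allI impI)
  show "(\<lambda>k. 2 * sqrt (real k) + 8) \<in> O(\<lambda>k. sqrt (real k))"
  proof (rule bigoI)
    \<comment> \<open>For \<open>k\<close> at least 1 the summand 8 is at most
      \<open>8 * sqrt k\<close>, hence the factor 10.\<close>
    show "\<forall>\<^sub>F k in sequentially. norm (2 * sqrt (real k) + 8) \<le> 10 * norm (sqrt (real k))"
      using eventually_ge_at_top[of 1] by eventually_elim simp
  qed
next
  fix n f :: nat and D :: real and \<rho> :: "nat \<Rightarrow> 'v config" and i r a
  assume "2 * f < n" "0 < D" "execution n f D \<rho>" "lattice_starts \<rho> i r a"
  then show "takes_at_most D \<rho> i r a (2 * sqrt (real (card (faulty \<rho>))) + 8)"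
    by (intro exec.lattice_delay exec.intro)
qed

end
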